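(* Let $q=f(z)dz^2$ be a holomorphic quadratic differential on $\mathbb{H}^2$. Suppose that (1) $q$ is bounded in the hyperbolic metric $\mathbf{g}_{\mathbb{H}^2}$, i.e. $\|q\|_{\mathbf{g}_{\mathbb{H}^2}}=|f(z)|\,\|dz^2\|_{\mathbf{g}_{\mathbb{H}^2}}\le D$, where $\|dz^2\|_{\mathbf{g}_{\mathbb{H}^2}}=\operatorname{Im}(z)^2$ and $D$ is a positive real number; (2) the first and second covariant derivatives of $q$ with respect to the linear connection $\nabla$ on $T^*\mathbb{H}^2\otimes_{\mathbb{C}}T^*\mathbb{H}^2$ are bounded in the hyperbolic metric $\mathbf{g}_{\mathbb{H}^2}$. Then there exists a harmonic vector field $\xi^{\mathrm{reg}}$ on $\mathbb{H}^2$ such that $(\mathcal{L}_{\xi^{\mathrm{reg}}}\mathbf{g}_{\mathbb{H}^2})^{(2,0)}=q$. An explicit formula is $$\xi^{\mathrm{reg}}(z)=\lim_{c\to\infty}\left(\xi_c(z)-\Big(\xi_c(i)+\frac{\partial\xi_c}{\partial z}\Big|_{z=i}\cdot(z-i)\Big)\right),$$ where, for a positive real number $c$, $$\xi_c(z)=\left(\int_{\operatorname{Im}(z)}^{c} i\,\zeta^2\,\overline{f(\bar z+2i\zeta)}\,d\zeta\right)\eta(z).$$ Moreover, the harmonic vector field $\xi^{\mathrm{reg}}$, transformed from $\mathbb{H}^2$ to the open unit disk $\mathbb{D}$ by the Cayley transform $C(z)=\frac{z-i}{z+i}$, extends to a continuous vector field $\chi$ on $\overline{\mathbb{D}}$ defined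 by $$\chi(C(z))=\begin{cases}C_*(\xi^{\mathrm{reg}}(z)) & z\in\mathbb{H}^2,\\ C_*(\xi^{\mathrm{reg}}(z)) & z\in\partial\mathbb{H}^2\setminus\{\infty\},\\ 0 & z=\infty,\end{cases}$$ where $C_*(\xi^{\mathrm{reg}}(z))$ is the pushforward of $\xi^{\mathrm{reg}}(z)$ by $C$.
   Context: $\mathbb{H}^2=\{x+iy\in\mathbb{C}: y>0\}$ carries the metric $\mathbf{g}_{\mathbb{H}^2}=(dx^2+dy^2)/y^2$; $\partial\mathbb{H}^2=\mathbb{R}\cup\{\infty\}$, and $C(\infty)=1$. Vector fields are identified with $\mathbb{C}$-valued functions, $\xi=(\xi^1,\xi^2)\leftrightarrow\xi^1+i\xi^2$; $\eta$ is the constant vector field $\eta(z)=(1,0)$. The connection $\nabla$ is the one induced by the Levi-Civita connection of $\mathbf{g}_{\mathbb{H}^2}$, extended complex-linearly. For $z\in\mathbb{R}$, $\xi_c(z)$ is defined as the improper integral $\lim_{\epsilon\to0^+}\int_\epsilon^c i\zeta^2\overline{f(z+2i\zeta)}\,d\zeta$ (times $\eta(z)$), and $\xi^{\mathrm{reg}}(z)$ is defined by the same limit formula. Harmonic vector field: for a smooth map $\phi:U\to \mathbb{H}^2$ from an open set $U\subseteq \mathbb{H}^2$, the tension field is $\tau(\phi)=\mathrm{trace}(\nabla d\phi)$, with $\nabla$ the connection on $T^*U\otimes\phi^{-1}T\mathbb{H}^2$ induced by the Levi-Civita connections. A smooth vector field $\xi$ on $U$ is harmonic if there is a smooth family of smooth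 maps $\phi_t:U\to \mathbb{H}^2$, $t\in[0,\epsilon)$, such that $\phi_0$ is the inclusion, $\frac{d\phi_t}{dt}|_{t=0}=\xi$, and $\frac{d}{dt}|_{t=0}\tau(\phi_t)(x)=0$ for all $x\in U$ (computed in the standard coordinates of $\mathbb{C}$). $(2,0)$-part: the trace-free part of the Lie derivative $\mathcal{L}_\xi\mathbf{g}_{\mathbb{H}^2}$ can be written uniquely as the real part of $h\,dz^2$ with $h$ complex-valued, and $(\mathcal{L}_\xi\mathbf{g}_{\mathbb{H}^2})^{(2,0)}:=h\,dz^2$; in coordinates $\overline{h(z)}=\frac{-8}{(z-\bar z)^2}\frac{\partial\xi}{\partial\bar z}$. *)

theory Defs
  imports "HOL-Complex_Analysis.Complex_Analysis"
begin

text \<open>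
  Vector fields on subsets of the plane are complex-valued functions, so the constant vector field
  \<open>\<eta> = (1, 0)\<close> is the constant function \<open>1\<close>. Differentials are real (Frechet) derivatives.
\<close>

definition upper_half_plane :: "complex set" where
  "upper_half_plane = {z. 0 < Im z}"


subsection \<open>Smooth maps\<close>

text \<open>
  Infinite real differentiability on \<open>S\<close>. At boundary points the derivative is taken within \<open>S\<close>;
  \<open>S\<close> is only ever an open set or \<open>{0..<\<epsilon>} \<times> U\<close> with \<open>U\<close> open, where that derivative is unique.
\<close>

coinductive smooth_on :: "'a::real_normed_vector set \<Rightarrow> ('a \<Rightarrow> 'b::real_normed_vector) \<Rightarrow> bool"
  for S where
  "\<lbrakk>\<And>x. x \<in> S \<Longrightarrow> (F has_derivative D x) (at x within S);
    \<And>v. smooth_on S (\<lambda>x. D x v)\<rbrakk> \<Longrightarrow> smooth_on S F"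


subsection \<open>The hyperbolic metric and its Levi-Civita connection\<close>

definition hyp_metric :: "complex \<Rightarrow> complex \<Rightarrow> complex \<Rightarrow> real" where
  "hyp_metric z u v = (u \<bullet> v) / (Im z)\<^sup>2"

definition hyp_norm :: "complex \<Rightarrow> complex \<Rightarrow> real" where
  "hyp_norm z v = sqrt (hyp_metric z v v)"

text \<open>
  \<open>christoffel z u v\<close> is \<open>\<nabla>\<^bsub>u\<^esub> v\<close> at \<open>z\<close> for constant vector fields \<open>u\<close> and \<open>v\<close>, given by the
  Koszul formula; on the coordinate fields its components are the Christoffel symbols.
\<close>

definition christoffel :: "complex \<Rightarrow> complex \<Rightarrow> complex \<Rightarrow> complex" where
  "christoffel z u v = (THE w. \<forall>e. 2 * hyp_metric z w e =
       frechet_derivative (\<lambda>p. hyp_metric p v e) (at z) u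
     + frechet_derivative (\<lambda>p. hyp_metric p u e) (at z) v
     - frechet_derivative (\<lambda>p. hyp_metric p u v) (at z) e)"


subsection \<open>Covariant derivatives of complex-valued covariant tensors\<close>

text \<open>
  A complex-valued covariant \<open>k\<close>-tensor field \<open>T\<close> is evaluated as \<open>T z vs\<close> on a list \<open>vs\<close> of
  \<open>k\<close> tangent vectors at \<open>z\<close>. In \<open>cov_deriv T z (u # vs)\<close>, \<open>u\<close> is the direction of
  differentiation.
\<close>

fun cov_deriv ::
  "(complex \<Rightarrow> complex list \<Rightarrow> complex) \<Rightarrow> complex \<Rightarrow> complex list \<Rightarrow> complex" where
  "cov_deriv T z [] = 0"
| "cov_deriv T z (u # vs) = frechet_derivative (\<lambda>p. T p vs) (at z) u
     - (\<Sum>i<length vs. T z (vs[i := christoffel z u (vs ! i)]))"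

definition quad_diff :: "(complex \<Rightarrow> complex) \<Rightarrow> complex \<Rightarrow> complex list \<Rightarrow> complex" where
  "quad_diff f z vs = f z * (vs ! 0) * (vs ! 1)"

text \<open>
  Boundedness of the pointwise operator norm of a \<open>k\<close>-tensor field; for \<open>dz\<^sup>2\<close> this norm
  is \<open>(Im z)\<^sup>2\<close>.
\<close>

definition hyp_bounded_tensor :: "nat \<Rightarrow> (complex \<Rightarrow> complex list \<Rightarrow> complex) \<Rightarrow> bool" where
  "hyp_bounded_tensor k T \<longleftrightarrow> (\<exists>B. \<forall>z\<in>upper_half_plane. \<forall>vs. length vs = k \<longrightarrow>
     cmod (T z vs) \<le> B * prod_list (map (hyp_norm z) vs))"


subsection \<open>Harmonic vector fields\<close>

definition cov_hessian ::
  "(complex \<Rightarrow> complex) \<Rightarrow> complex \<Rightarrow> complex \<Rightarrow> complex \<Rightarrow> complex" where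
  "cov_hessian \<phi> z u v =
     frechet_derivative (\<lambda>p. frechet_derivative \<phi> (at p) v) (at z) u
     + christoffel (\<phi> z) (frechet_derivative \<phi> (at z) u) (frechet_derivative \<phi> (at z) v)
     - frechet_derivative \<phi> (at z) (christoffel z u v)"

text \<open>The vectors \<open>Im z *\<^sub>R b\<close> with \<open>b \<in> Basis = {1, \<i>}\<close> are orthonormal for the metric at \<open>z\<close>.\<close>

definition tension :: "(complex \<Rightarrow> complex) \<Rightarrow> complex \<Rightarrow> complex" where
  "tension \<phi> z = (\<Sum>b\<in>Basis. cov_hessian \<phi> z (Im z *\<^sub>R b) (Im z *\<^sub>R b))"

text \<open>Joint smoothness in \<open>(t, z)\<close> includes smoothness of each \<open>\<phi> t\<close>.\<close>

definition harmonic_vector_field :: "complex set \<Rightarrow> (complex \<Rightarrow> complex) \<Rightarrow> bool" where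
  "harmonic_vector_field U \<xi> \<longleftrightarrow>
     open U \<and> U \<subseteq> upper_half_plane \<and> smooth_on U \<xi> \<and>
     (\<exists>\<epsilon>>0. \<exists>\<phi> :: real \<Rightarrow> complex \<Rightarrow> complex.
        smooth_on ({0..<\<epsilon>} \<times> U) (\<lambda>(t, z). \<phi> t z) \<and>
        (\<forall>t\<in>{0..<\<epsilon>}. \<forall>z\<in>U. \<phi> t z \<in> upper_half_plane) \<and>
        (\<forall>z\<in>U. \<phi> 0 z = z) \<and>
        (\<forall>z\<in>U. ((\<lambda>t. \<phi> t z) has_vector_derivative \<xi> z) (at 0 within {0..<\<epsilon>})) \<and>
        (\<forall>z\<in>U. ((\<lambda>t. tension (\<phi> t) z) has_vector_derivative 0) (at 0 within {0..<\<epsilon>})))"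


subsection \<open>The (2,0)-part of the Lie derivative of the metric\<close>

definition lie_metric :: "(complex \<Rightarrow> complex) \<Rightarrow> complex \<Rightarrow> complex \<Rightarrow> complex \<Rightarrow> real" where
  "lie_metric \<xi> z u v =
     frechet_derivative (\<lambda>p. hyp_metric p u v) (at z) (\<xi> z)
     + hyp_metric z (frechet_derivative \<xi> (at z) u) v
     + hyp_metric z u (frechet_derivative \<xi> (at z) v)"

definition trace_free_part ::
  "(complex \<Rightarrow> complex \<Rightarrow> complex \<Rightarrow> real) \<Rightarrow> complex \<Rightarrow> complex \<Rightarrow> complex \<Rightarrow> real" where
  "trace_free_part S z u v =
     S z u v - (\<Sum>b\<in>Basis. S z (Im z *\<^sub>R b) (Im z *\<^sub>R b)) / 2 * hyp_metric z u v"

text \<open>The coefficient \<open>h\<close> in \<open>(\<L>\<^bsub>\<xi>\<^esub> g)\<^bsup>(2,0)\<^esup> = h dz\<^sup>2\<close>.\<close>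

definition lie_metric_20 :: "(complex \<Rightarrow> complex) \<Rightarrow> complex \<Rightarrow> complex" where
  "lie_metric_20 \<xi> z = (THE h. \<forall>u v. trace_free_part (lie_metric \<xi>) z u v = Re (h * u * v))"


subsection \<open>The explicit formula\<close>

definition wirtinger :: "(complex \<Rightarrow> complex) \<Rightarrow> complex \<Rightarrow> complex" where
  "wirtinger F z =
     (frechet_derivative F (at z) 1 - \<i> * frechet_derivative F (at z) \<i>) / 2"

text \<open>The integral is oriented, so it is also meaningful for \<open>b < a\<close>.\<close>

definition xi_integral :: "(complex \<Rightarrow> complex) \<Rightarrow> complex \<Rightarrow> real \<Rightarrow> real \<Rightarrow> complex" where
  "xi_integral f z a b =
     (LBINT \<zeta>=ereal a..ereal b.
        \<i> * (complex_of_real \<zeta>)\<^sup>2 * cnj (f (cnj z + 2 * \<i> * complex_of_real \<zeta>)))"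

text \<open>
  The second case is for real \<open>z\<close>, where the integral from \<open>0\<close> is improper. \<open>Lim\<close> is
  unspecified unless the limit exists.
\<close>

definition xi_c :: "(complex \<Rightarrow> complex) \<Rightarrow> real \<Rightarrow> complex \<Rightarrow> complex" where
  "xi_c f c z = (if 0 < Im z then xi_integral f z (Im z) c
     else Lim (at_right 0) (\<lambda>\<epsilon>. xi_integral f z \<epsilon> c))"

definition xi_c_normalized :: "(complex \<Rightarrow> complex) \<Rightarrow> real \<Rightarrow> complex \<Rightarrow> complex" where
  "xi_c_normalized f c z = xi_c f c z - (xi_c f c \<i> + wirtinger (xi_c f c) \<i> * (z - \<i>))"


subsection \<open>The Cayley transform\<close>

definition cayley :: "complex \<Rightarrow> complex" where
  "cayley z = (z - \<i>) / (z + \<i>)"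

definition cayley_push :: "complex \<Rightarrow> complex \<Rightarrow> complex" where
  "cayley_push z v = frechet_derivative cayley (at z) v"

end

theory Submission
  imports Defs
begin

text \<open>
  Let \<open>F1\<close>, \<open>F2\<close>, \<open>F3\<close> be iterated primitives of \<open>f\<close>, with \<open>F1\<close> vanishing at infinity. Integration by
  parts gives \<open>\<xi>\<^sub>c z = P z - cnj (S c (cnj z + 2 \<i> c))\<close>, where \<open>P\<close> is explicit in \<open>F1\<close>, \<open>F2\<close>, \<open>F3\<close> and
  \<open>Im z\<close>, and where the second derivative of \<open>u \<mapsto> S c (u + 2 \<i> c)\<close> is of order \<open>1/c\<close>. By Taylor's
  formula the second term disappears in the normalised limit, and the constants in \<open>F2\<close> and \<open>F3\<close> can be
  chosen so that the limit is \<open>P\<close> itself. Since \<open>|F1| \<le> D / Im z\<close>, the gradient of \<open>P\<close> is at most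
  \<open>K (1 + |z|)\<^bsup>1/2\<^esup> (1 + (Im z)\<^bsup>-1/2\<^esup>)\<close>. This is integrable down to the boundary and gives growth of order
  \<open>|z|\<^bsup>3/2\<^esup>\<close> at infinity, hence the continuous extension to the closed disk.
\<close>

subsection \<open>Smooth maps\<close>

text \<open>Why an affine correction suffices: all dependence of \<open>\<xi>\<^sub>c\<close> on
  \<open>c\<close> sits in \<open>cnj (S c (cnj z + 2 * \<i> * c))\<close>, which is holomorphic in
  \<open>z\<close>, so its value and Wirtinger derivative at \<open>\<i>\<close> form its full
  first-order Taylor polynomial. Working with primitives also avoids differentiation under the
  integral: smoothness, harmonicity and the Lie derivative become algebra in \<open>f\<close>,
  \<open>F1\<close>, \<open>F2\<close>, \<open>F3\<close>. The delicate function is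
  \<open>F2\<close>, which the bound on \<open>F1\<close> controls only logarithmically, both at the
  real line and at infinity. Square roots replace the logarithms: the exponent -1/2 is still
  integrable at the real line, and the resulting growth exponent 3/2 stays below 2, the order to
  which the Cayley differential vanishes at infinity. Harmonicity asks for an actual family of maps
  into the half-plane. A second-order correction supplies one for any smooth field, so that only a
  linear equation remains; for \<open>P\<close> it says that the \<open>cnj v\<close> coefficient of
  its derivative, divided by \<open>(Im z)\<^sup>2\<close>, is antiholomorphic, and this quotient is
  \<open>cnj (f z) / 2\<close>.\<close>

lemma smooth_on_cong:
  assumes "smooth_on S F" "\<And>x. x \<in> S \<Longrightarrow> F x = G x"
  shows "smooth_on S G"
  using assms(1)
proof cases
  case (1 D)
  show ?thesis
    by (rule smooth_on.intros[of S G D])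
       (use 1 assms(2) in \<open>auto intro: has_derivative_transform[of _ _ G F]\<close>)
qed

text \<open>Linearity closes the coinduction: the derivative along \<open>v\<close> is again a
  smooth function composed with \<open>L\<close>, namely
  \<open>\<lambda>x. D x (L v)\<close>.\<close>

lemma smooth_on_compose_linear:
  assumes "smooth_on U F" "bounded_linear L" "L ` S \<subseteq> U"
  shows "smooth_on S (\<lambda>x. F (L x))"
  using assms(1)
proof (coinduction arbitrary: F)
  case (smooth_on F)
  then show ?case
  proof cases
    case (1 D)
    have "((\<lambda>x. F (L x)) has_derivative (\<lambda>v. D (L x) (L v))) (at x within S)" if "x \<in> S" for x
    proof -
      have "(F has_derivative D (L x)) (at (L x) within L ` S)"
        using 1(1)[of "L x"] assms(3) that has_derivative_subset by blast
      then show ?thesis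
        by (rule has_derivative_in_compose[OF bounded_linear_imp_has_derivative[OF assms(2)]])
    qed
    then show ?thesis
      using 1(2)
      by (intro exI[of _ "\<lambda>x. F (L x)"] exI[of _ "\<lambda>x v. D (L x) (L v)"] conjI allI impI disjI1
          exI[of _ "\<lambda>x. D x (L v)" for v]) auto
  qed
qed

text \<open>Products differentiate to sums of products, so coinduction needs the algebra generated by the
  functions in question: it is closed under directional derivatives as a whole.\<close>

inductive smooth_alg :: "'a::real_normed_vector set \<Rightarrow> ('a \<Rightarrow> complex) \<Rightarrow> bool" for S where
  base: "smooth_on S F \<Longrightarrow> smooth_alg S F"
| add: "smooth_alg S F \<Longrightarrow> smooth_alg S G \<Longrightarrow> smooth_alg S (\<lambda>x. F x + G x)"
| mult: "smooth_alg S F \<Longrightarrow> smooth_alg S G \<Longrightarrow> smooth_alg S (\<lambda>x. F x * G x)"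
| linear: "bounded_linear L \<Longrightarrow> smooth_alg S F \<Longrightarrow> smooth_alg S (\<lambda>x. L (F x))"
| inverse: "smooth_alg S F \<Longrightarrow> (\<And>x. x \<in> S \<Longrightarrow> F x \<noteq> 0) \<Longrightarrow> smooth_alg S (\<lambda>x. inverse (F x))"

lemma smooth_alg_derivative:
  assumes "smooth_alg S F"
  shows "\<exists>D. (\<forall>x\<in>S. (F has_derivative D x) (at x within S)) \<and> (\<forall>v. smooth_alg S (\<lambda>x. D x v))"
  using assms
proof induction
  case (base F)
  then show ?case by (cases rule: smooth_on.cases) (blast intro: smooth_alg.base)
next
  case (add F G)
  then obtain D E where
    "\<forall>x\<in>S. (F has_derivative D x) (at x within S)" "\<forall>v. smooth_alg S (\<lambda>x. D x v)"
    "\<forall>x\<in>S. (G has_derivative E x) (at x within S)" "\<forall>v. smooth_alg S (\<lambda>x. E x v)"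
    by blast
  then show ?case
    by (intro exI[of _ "\<lambda>x v. D x v + E x v"]) (auto intro: has_derivative_add smooth_alg.add)
next
  case (mult F G)
  then obtain D E where
    "\<forall>x\<in>S. (F has_derivative D x) (at x within S)" "\<forall>v. smooth_alg S (\<lambda>x. D x v)"
    "\<forall>x\<in>S. (G has_derivative E x) (at x within S)" "\<forall>v. smooth_alg S (\<lambda>x. E x v)"
    by blast
  with mult.hyps show ?case
    by (intro exI[of _ "\<lambda>x v. F x * E x v + D x v * G x"])
       (auto intro!: has_derivative_mult smooth_alg.add smooth_alg.mult)
next
  case (linear L F)
  then obtain D where
    "\<forall>x\<in>S. (F has_derivative D x) (at x within S)" "\<forall>v. smooth_alg S (\<lambda>x. D x v)"
    by blast
  with linear.hyps show ?case
    by (intro exI[of _ "\<lambda>x v. L (D x v)"])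
       (auto intro: bounded_linear.has_derivative smooth_alg.linear)
next
  case (inverse F)
  then obtain D where D:
    "\<forall>x\<in>S. (F has_derivative D x) (at x within S)" "\<forall>v. smooth_alg S (\<lambda>x. D x v)"
    by blast
  have "smooth_alg S (\<lambda>x. - (inverse (F x) * D x v * inverse (F x)))" for v
    using D(2) inverse.hyps
    by (intro smooth_alg.linear[OF bounded_linear_minus[OF bounded_linear_ident]]
        smooth_alg.mult smooth_alg.inverse) auto
  with D(1) inverse.hyps show ?case
    by (intro exI[of _ "\<lambda>x v. - (inverse (F x) * D x v * inverse (F x))"])
       (auto intro!: has_derivative_inverse)
qed

lemma smooth_on_alg:
  assumes "smooth_alg S F"
  shows "smooth_on S F"
  using assms
proof (coinduction arbitrary: F)
  case (smooth_on F)
  then obtain D where "\<forall>x\<in>S. (F has_derivative D x) (at x within S)"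
      "\<forall>v. smooth_alg S (\<lambda>x. D x v)"
    using smooth_alg_derivative by blast
  then show ?case
    by (intro exI[of _ F] exI[of _ D]) auto
qed

lemma smooth_on_const: "smooth_on S (\<lambda>x. c)"
proof (coinduction arbitrary: c)
  case smooth_on
  then show ?case by (intro exI[of _ "\<lambda>x. c"] exI[of _ "\<lambda>x v. 0"]) auto
qed

lemma smooth_on_linear: "bounded_linear L \<Longrightarrow> smooth_on S L"
  by (rule smooth_on.intros[of S L "\<lambda>x. L"])
     (auto intro: bounded_linear_imp_has_derivative smooth_on_const)

lemma smooth_on_holomorphic:
  assumes "F holomorphic_on U" "open U"
  shows "smooth_on U F"
proof -
  \<comment> \<open>The constant factor makes the family closed under directional derivatives: along
    \<open>v\<close> one gets \<open>deriv G\<close> times the constant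
    \<open>v * c\<close>.\<close>
  have "smooth_on U (\<lambda>x. G x * c)" if "G holomorphic_on U" for G c
    using that
  proof (coinduction arbitrary: G c)
    case smooth_on
    have "((\<lambda>x. G x * c) has_derivative (\<lambda>v. deriv G x * v * c)) (at x within U)" if "x \<in> U" for x
    proof -
      have "(G has_derivative (\<lambda>v. deriv G x * v)) (at x)"
        using holomorphic_derivI[OF smooth_on assms(2) that] by (simp add: has_field_derivative_def)
      then show ?thesis
        by (rule has_derivative_at_withinI[OF has_derivative_mult_left])
    qed
    moreover have "\<exists>H d. (\<lambda>x. deriv G x * v * c) = (\<lambda>x. H x * d) \<and> H holomorphic_on U" for v
      using holomorphic_deriv[OF smooth_on assms(2)]
      by (intro exI[of _ "deriv G"] exI[of _ "v * c"]) (auto simp: mult.assoc)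
    ultimately show ?case
      by (intro exI[of _ "\<lambda>x. G x * c"], intro exI[of _ "\<lambda>x v. deriv G x * v * c"]) simp
  qed
  from this[OF assms(1), of 1] show ?thesis by simp
qed

lemma smooth_on_frechet_derivative:
  assumes "smooth_on U F" "open U"
  shows "x \<in> U \<Longrightarrow> F differentiable (at x)" "smooth_on U (\<lambda>x. frechet_derivative F (at x) v)"
proof -
  obtain D where D: "\<And>x. x \<in> U \<Longrightarrow> (F has_derivative D x) (at x within U)"
      "\<And>v. smooth_on U (\<lambda>x. D x v)"
    using assms(1) by (cases rule: smooth_on.cases) blast
  then have D': "(F has_derivative D x) (at x)" if "x \<in> U" for x
    using assms(2) that at_within_open by metis
  then show "x \<in> U \<Longrightarrow> F differentiable (at x)"
    by (auto simp: differentiable_def)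
  show "smooth_on U (\<lambda>x. frechet_derivative F (at x) v)"
    using D(2) by (rule smooth_on_cong) (simp add: frechet_derivative_at[OF D', symmetric])
qed


subsection \<open>Hyperbolic geometry of vector fields\<close>

lemma mem_upper_half_plane [simp]: "z \<in> upper_half_plane \<longleftrightarrow> 0 < Im z"
  by (simp add: upper_half_plane_def)

lemma open_upper_half_plane: "open upper_half_plane"
  by (simp add: upper_half_plane_def open_halfspace_Im_gt)

lemma convex_upper_half_plane: "convex upper_half_plane"
  by (simp add: upper_half_plane_def convex_halfspace_Im_gt)

lemma hyp_metric_has_derivative:
  assumes "0 < Im z"
  shows "((\<lambda>p. hyp_metric p v e) has_derivative (\<lambda>u. - 2 * (v \<bullet> e) * Im u / Im z ^ 3)) (at z)"
proof -
  have "((\<lambda>p. (v \<bullet> e) / (Im p)\<^sup>2) has_derivative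
      (\<lambda>u. - 2 * (v \<bullet> e) * Im u / Im z ^ 3)) (at z)"
    by (rule derivative_eq_intros refl bounded_linear_imp_has_derivative bounded_linear_Im | use assms in force)+
       (use assms in \<open>auto simp: fun_eq_iff field_simps power2_eq_square power3_eq_cube\<close>)
  then show ?thesis
    by (simp add: hyp_metric_def)
qed

text \<open>The metric is conformal to the Euclidean one with factor \<open>1 / Im z\<close>, so its
  connection is complex bilinear in this coordinate; the coefficient is twice the Wirtinger
  derivative of the logarithm of that factor.\<close>

lemma christoffel_eq:
  assumes "0 < Im z"
  shows "christoffel z u v = \<i> * u * v / Im z"
proof -
  have fd: "frechet_derivative (\<lambda>p. hyp_metric p a b) (at z) c = - 2 * (a \<bullet> b) * Im c / Im z ^ 3" for a b c
    using frechet_derivative_at[OF hyp_metric_has_derivative[OF assms], of a b] by metis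
  show ?thesis
    unfolding christoffel_def fd
  proof (rule the_equality)
    show "\<forall>e. 2 * hyp_metric z (\<i> * u * v / Im z) e =
      - 2 * (v \<bullet> e) * Im u / Im z ^ 3 + - 2 * (u \<bullet> e) * Im v / Im z ^ 3
      - - 2 * (u \<bullet> v) * Im e / Im z ^ 3"
      using assms by (auto simp: hyp_metric_def inner_complex_def Re_divide Im_divide field_simps
          power2_eq_square power3_eq_cube)
  next
    fix w
    assume w: "\<forall>e. 2 * hyp_metric z w e =
      - 2 * (v \<bullet> e) * Im u / Im z ^ 3 + - 2 * (u \<bullet> e) * Im v / Im z ^ 3
      - - 2 * (u \<bullet> v) * Im e / Im z ^ 3"
    have "Im z * Re w = - (Re v * Im u) - Re u * Im v"
      using spec[OF w, of 1] assms
      by (auto simp: hyp_metric_def inner_complex_def field_simps power2_eq_square power3_eq_cube)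
    then have "Re w = Re (\<i> * u * v / Im z)"
      using assms by (simp add: Re_divide_of_real field_simps)
    moreover have "Im z * Im w = Re u * Re v - Im u * Im v"
      using spec[OF w, of \<i>] assms
      by (auto simp: hyp_metric_def inner_complex_def field_simps power2_eq_square power3_eq_cube)
    then have "Im w = Im (\<i> * u * v / Im z)"
      using assms by (simp add: Im_divide_of_real field_simps)
    ultimately show "w = \<i> * u * v / Im z"
      by (rule complex_eqI)
  qed
qed

section \<open>The tension field and its linearisation at the inclusion\<close>

lemma sum_Basis_complex: "(\<Sum>b\<in>Basis. g b) = g 1 + g \<i>"
  by (simp add: Basis_complex_def)

text \<open>The source connection drops out of the trace because
  \<open>1 + \<i>\<^sup>2 = 0\<close>. What remains is the Euclidean Laplacian and the connection of
  the target.\<close>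

lemma tension_eq:
  assumes U: "open U" "z \<in> U" and pos: "0 < Im z" "0 < Im (\<phi> z)"
    and D1: "\<And>p. p \<in> U \<Longrightarrow> (\<phi> has_derivative D1 p) (at p)"
    and D2: "\<And>v. ((\<lambda>p. D1 p v) has_derivative D2 v) (at z)"
  shows "tension \<phi> z = (Im z)\<^sup>2 *
    (D2 1 1 + D2 \<i> \<i> + \<i> / Im (\<phi> z) * ((D1 z 1)\<^sup>2 + (D1 z \<i>)\<^sup>2))"
proof -
  have f1: "frechet_derivative \<phi> (at p) = D1 p" if "p \<in> U" for p
    using frechet_derivative_at[OF D1[OF that]] by simp
  have f2: "frechet_derivative (\<lambda>p. frechet_derivative \<phi> (at p) v) (at z) = D2 v" for v
    by (rule frechet_derivative_at[symmetric], rule has_derivative_transform_within_open[OF D2 U])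
       (simp add: f1)
  have lin1: "linear (D1 p)" if "p \<in> U" for p
    using D1[OF that] has_derivative_linear by blast
  have lin2: "linear (D2 v)" for v
    using D2 has_derivative_linear by blast
  \<comment> \<open>Homogeneity in \<open>v\<close> is inherited from the linearity of each
    \<open>D1 p\<close> by uniqueness of derivatives; it lets the factor \<open>Im z\<close> leave
    the frame vectors.\<close>
  have D2s: "D2 (r *\<^sub>R v) = (\<lambda>h. r *\<^sub>R D2 v h)" for r v
  proof -
    have "((\<lambda>p. D1 p (r *\<^sub>R v)) has_derivative (\<lambda>h. r *\<^sub>R D2 v h)) (at z)"
      by (rule has_derivative_transform_within_open[OF has_derivative_scaleR_right[OF D2] U])
         (simp add: linear_scale[OF lin1])
    then show ?thesis
      using has_derivative_unique[OF D2] by blast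
  qed
  have hess: "cov_hessian \<phi> z (Im z *\<^sub>R b) (Im z *\<^sub>R b) =
      (Im z)\<^sup>2 * (D2 b b + \<i> / Im (\<phi> z) * (D1 z b)\<^sup>2) - D1 z (Im z *\<^sub>R (\<i> * b\<^sup>2))" for b
  proof -
    have "\<i> * (Im z *\<^sub>R b) * (Im z *\<^sub>R b) / Im z = Im z *\<^sub>R (\<i> * b\<^sup>2)"
      using pos by (simp add: scaleR_conv_of_real field_simps power2_eq_square)
    moreover have "D2 (Im z *\<^sub>R b) (Im z *\<^sub>R b) = (Im z)\<^sup>2 * D2 b b"
      unfolding D2s linear_scale[OF lin2] by (simp add: scaleR_conv_of_real power2_eq_square)
    moreover have "D1 z (Im z *\<^sub>R b) = Im z * D1 z b"
      unfolding linear_scale[OF lin1[OF U(2)]] by (simp add: scaleR_conv_of_real)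
    ultimately show ?thesis
      unfolding cov_hessian_def f2 f1[OF U(2)] christoffel_eq[OF pos(1)] christoffel_eq[OF pos(2)]
      by (simp add: power2_eq_square algebra_simps)
  qed
  have "D1 z (Im z *\<^sub>R (- \<i>)) = - D1 z (Im z *\<^sub>R \<i>)"
    using linear_neg[OF lin1[OF U(2)], of "Im z *\<^sub>R \<i>"] by simp
  then show ?thesis
    unfolding tension_def sum_Basis_complex hess by (simp add: algebra_simps)
qed

text \<open>The equation is the derivative at \<open>t = 0\<close> of the formula in
  \<open>tension_eq\<close>. For the inclusion the sum of squares there is
  \<open>1 + \<i>\<^sup>2 = 0\<close>, so the variation of \<open>Im (\<phi> z)\<close> in the
  denominator contributes nothing.\<close>

lemma harmonic_vector_fieldI:
  assumes U: "open U" "U \<subseteq> upper_half_plane" and smooth: "smooth_on U \<xi>"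
    and D1: "\<And>p. p \<in> U \<Longrightarrow> (\<xi> has_derivative D1 p) (at p)"
    and D2: "\<And>z v. z \<in> U \<Longrightarrow> ((\<lambda>p. D1 p v) has_derivative D2 z v) (at z)"
    and eq: "\<And>z. z \<in> U \<Longrightarrow>
      D2 z 1 1 + D2 z \<i> \<i> + 2 * \<i> / Im z * (D1 z 1 + \<i> * D1 z \<i>) = 0"
  shows "harmonic_vector_field U \<xi>"
proof -
  \<comment> \<open>\<open>z + t \<xi> z\<close> may leave the half-plane; the term \<open>t\<^sup>2 \<kappa> z\<close> prevents this for every \<open>t\<close>.\<close>
  define \<kappa> where "\<kappa> z = \<i> / 2 * (complex_of_real (Im (\<xi> z)) * complex_of_real (Im (\<xi> z)))
    * inverse (complex_of_real (Im z))" for z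
  define \<phi> where "\<phi> t z = z + complex_of_real t * \<xi> z + complex_of_real t * complex_of_real t * \<kappa> z" for t z
  have lin_Im: "bounded_linear (\<lambda>z. complex_of_real (Im z))"
    by (rule bounded_linear_compose[OF bounded_linear_of_real bounded_linear_Im])
  have posU: "0 < Im z" if "z \<in> U" for z
    using U(2) that by auto
  have alg_\<xi>: "smooth_alg U (\<lambda>z. complex_of_real (Im (\<xi> z)))"
    by (rule smooth_alg.linear[OF lin_Im smooth_alg.base[OF smooth]])
  have alg_inv: "smooth_alg U (\<lambda>z. inverse (complex_of_real (Im z)))"
    by (rule smooth_alg.inverse[OF smooth_alg.base[OF smooth_on_linear[OF lin_Im]]])
       (use posU in force)
  have smooth_\<kappa>: "smooth_on U \<kappa>"
    unfolding \<kappa>_def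
    by (rule smooth_on_alg[OF smooth_alg.mult[OF smooth_alg.mult[OF smooth_alg.base[OF smooth_on_const]
        smooth_alg.mult[OF alg_\<xi> alg_\<xi>]] alg_inv]])
  define K1 where "K1 p = frechet_derivative \<kappa> (at p)" for p
  define K2 where "K2 z v = frechet_derivative (\<lambda>p. K1 p v) (at z)" for z v
  have K1: "(\<kappa> has_derivative K1 p) (at p)" if "p \<in> U" for p
    using smooth_on_frechet_derivative(1)[OF smooth_\<kappa> U(1) that]
    by (simp add: K1_def frechet_derivative_works)
  have K2: "((\<lambda>p. K1 p v) has_derivative K2 z v) (at z)" if "z \<in> U" for z v
    using smooth_on_frechet_derivative(1)[OF smooth_on_frechet_derivative(2)[OF smooth_\<kappa> U(1)] U(1) that]
    by (simp add: K1_def K2_def frechet_derivative_works)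
  have alg_t: "smooth_alg ({0..<1} \<times> U) (\<lambda>x. complex_of_real (fst x))"
    by (rule smooth_alg.base[OF smooth_on_linear[OF bounded_linear_compose[OF bounded_linear_of_real bounded_linear_fst]]])
  have alg_snd: "smooth_alg ({0..<1} \<times> U) (\<lambda>x. F (snd x))" if "smooth_on U F" for F
    by (rule smooth_alg.base[OF smooth_on_compose_linear[OF that bounded_linear_snd]]) auto
  have "smooth_on ({0..<1} \<times> U) (\<lambda>x. snd x + complex_of_real (fst x) * \<xi> (snd x)
      + complex_of_real (fst x) * complex_of_real (fst x) * \<kappa> (snd x))"
    by (rule smooth_on_alg[OF smooth_alg.add[OF smooth_alg.add[OF
        alg_snd[OF smooth_on_linear[OF bounded_linear_ident]] smooth_alg.mult[OF alg_t alg_snd[OF smooth]]]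
        smooth_alg.mult[OF smooth_alg.mult[OF alg_t alg_t] alg_snd[OF smooth_\<kappa>]]]])
  then have smooth_\<phi>: "smooth_on ({0..<1} \<times> U) (\<lambda>(t, z). \<phi> t z)"
    unfolding \<phi>_def case_prod_beta' .
  have Im_\<kappa>: "Im (\<kappa> z) = (Im (\<xi> z))\<^sup>2 / (2 * Im z)" for z
  proof -
    have "\<kappa> z = complex_of_real ((Im (\<xi> z))\<^sup>2 / (2 * Im z)) * \<i>"
      unfolding \<kappa>_def by (cases "Im z = 0") (simp_all add: field_simps power2_eq_square)
    then show ?thesis
      by (simp only: Im_i_times mult.commute[of _ \<i>] Re_complex_of_real)
  qed
  \<comment> \<open>Completing the square: the coefficient 1/2 in \<open>\<kappa>\<close> leaves
    \<open>Im z / 2\<close> as a lower bound for every \<open>t\<close>.\<close>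
  have Im_\<phi>: "Im (\<phi> t z) = ((Im z)\<^sup>2 + (Im z + t * Im (\<xi> z))\<^sup>2) / (2 * Im z)" if "z \<in> U" for t z
    unfolding \<phi>_def using posU[OF that]
    by (simp add: Im_\<kappa>) (simp add: field_simps power2_eq_square)
  have pos_\<phi>: "0 < Im (\<phi> t z)" if "z \<in> U" for t z
    unfolding Im_\<phi>[OF that] using posU[OF that]
    by (intro divide_pos_pos add_pos_nonneg) auto
  have tension_\<phi>: "tension (\<phi> t) z = (Im z)\<^sup>2 *
     ((of_real t * D2 z 1 1 + of_real t * of_real t * K2 z 1 1)
      + (of_real t * D2 z \<i> \<i> + of_real t * of_real t * K2 z \<i> \<i>)
      + \<i> / Im (\<phi> t z) * ((1 + of_real t * D1 z 1 + of_real t * of_real t * K1 z 1)\<^sup>2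
        + (\<i> + of_real t * D1 z \<i> + of_real t * of_real t * K1 z \<i>)\<^sup>2))" if z: "z \<in> U" for t z
  proof (rule tension_eq[where ?D1.0 = "\<lambda>p v. v + of_real t * D1 p v + of_real t * of_real t * K1 p v"
        and ?D2.0 = "\<lambda>v h. of_real t * D2 z v h + of_real t * of_real t * K2 z v h"])
    show "(\<phi> t has_derivative (\<lambda>v. v + of_real t * D1 p v + of_real t * of_real t * K1 p v)) (at p)"
      if "p \<in> U" for p
      unfolding \<phi>_def
      by (intro has_derivative_add has_derivative_ident has_derivative_mult_right D1 K1 that)
    show "((\<lambda>p. v + of_real t * D1 p v + of_real t * of_real t * K1 p v) has_derivative
        (\<lambda>h. of_real t * D2 z v h + of_real t * of_real t * K2 z v h)) (at z)" for v
      by (rule derivative_eq_intros D2 K2 z refl)+ simp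
  qed (use U(1) z posU pos_\<phi> in auto)
  have d\<phi>: "((\<lambda>t. \<phi> t z) has_vector_derivative \<xi> z) (at 0 within {0..<1})" for z
  proof -
    have "((\<lambda>s. z + s * \<xi> z + s * s * \<kappa> z) has_field_derivative \<xi> z) (at (of_real 0))"
      by (auto intro!: derivative_eq_intros)
    from has_vector_derivative_real_field[OF this] show ?thesis
      by (simp add: \<phi>_def)
  qed
  have d\<tau>: "((\<lambda>t. tension (\<phi> t) z) has_vector_derivative 0) (at 0 within {0..<1})" if z: "z \<in> U" for z
  proof -
    \<comment> \<open>The tension is rational in \<open>t\<close>, so \<open>t\<close> is replaced
      by a complex variable \<open>s\<close> and the rules for complex derivatives apply.\<close>
    define y b where "y = complex_of_real (Im z)" and "b = complex_of_real (Im (\<xi> z))"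
    have y0: "y \<noteq> 0"
      using posU[OF z] by (simp add: y_def)
    define N where "N s = (1 + s * D1 z 1 + s * s * K1 z 1)\<^sup>2 + (\<i> + s * D1 z \<i> + s * s * K1 z \<i>)\<^sup>2" for s
    define M where "M s = (y\<^sup>2 + (y + s * b)\<^sup>2) / (2 * y)" for s
    define L where "L s = (s * D2 z 1 1 + s * s * K2 z 1 1) + (s * D2 z \<i> \<i> + s * s * K2 z \<i> \<i>)" for s
    have N: "(N has_field_derivative (2 * D1 z 1 + 2 * \<i> * D1 z \<i>)) (at 0)"
      unfolding N_def by (auto intro!: derivative_eq_intros)
    have M: "(M has_field_derivative b) (at 0)"
      unfolding M_def using y0 by (auto intro!: derivative_eq_intros simp: field_simps power2_eq_square)
    have L: "(L has_field_derivative (D2 z 1 1 + D2 z \<i> \<i>)) (at 0)"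
      unfolding L_def by (auto intro!: derivative_eq_intros)
    have N0: "N 0 = 0" and M0: "M 0 = y"
      using y0 by (auto simp: N_def M_def field_simps power2_eq_square)
    have eq': "D2 z 1 1 + D2 z \<i> \<i> + \<i> / y * (2 * D1 z 1 + 2 * \<i> * D1 z \<i>) = 0"
    proof -
      have "\<i> / y * (2 * D1 z 1 + 2 * \<i> * D1 z \<i>) = 2 * \<i> / Im z * (D1 z 1 + \<i> * D1 z \<i>)"
        using y0 by (simp add: y_def field_simps)
      then show ?thesis
        using eq[OF z] by simp
    qed
    have "((\<lambda>s. y\<^sup>2 * (L s + \<i> / M s * N s)) has_field_derivative
        y\<^sup>2 * (D2 z 1 1 + D2 z \<i> \<i> + \<i> / y * (2 * D1 z 1 + 2 * \<i> * D1 z \<i>))) (at 0)"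
      by (rule derivative_eq_intros N M L refl | simp add: N0 M0 y0)+
    then have "((\<lambda>s. y\<^sup>2 * (L s + \<i> / M s * N s)) has_field_derivative 0) (at (of_real 0))"
      unfolding eq' by simp
    from has_vector_derivative_real_field[OF this, of "{0..<1}"] show ?thesis
      unfolding tension_\<phi>[OF z] Im_\<phi>[OF z] by (simp add: L_def M_def N_def y_def b_def)
  qed
  show ?thesis
    unfolding harmonic_vector_field_def
    by (intro conjI U smooth exI[of _ 1] exI[of _ \<phi>] ballI smooth_\<phi> d\<phi> d\<tau>)
       (auto simp: pos_\<phi>, simp add: \<phi>_def)
qed

text \<open>Here \<open>a\<close> and \<open>b\<close> are the Wirtinger derivatives of the field.
  The derivative of the metric and the part from \<open>a\<close> are multiples of the metric, hence
  pure trace; \<open>b\<close> survives through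
  \<open>u \<bullet> (b * cnj v) = Re (cnj b * u * v)\<close>.\<close>

lemma lie_metric_20_eq:
  assumes "0 < Im z" and D: "(\<xi> has_derivative (\<lambda>v. a * v + b * cnj v)) (at z)"
  shows "lie_metric_20 \<xi> z = 2 * cnj b / (Im z)\<^sup>2"
proof -
  have fd: "frechet_derivative (\<lambda>p. hyp_metric p u v) (at z) c = - 2 * (u \<bullet> v) * Im c / Im z ^ 3" for u v c
    using frechet_derivative_at[OF hyp_metric_has_derivative[OF assms(1)], of u v] by metis
  have f\<xi>: "frechet_derivative \<xi> (at z) v = a * v + b * cnj v" for v
    using frechet_derivative_at[OF D] by metis
  have lie: "lie_metric \<xi> z u v = - 2 * (u \<bullet> v) * Im (\<xi> z) / Im z ^ 3
      + 2 * (Re a * (u \<bullet> v) + Re (cnj b * u * v)) / (Im z)\<^sup>2" for u v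
    unfolding lie_metric_def fd f\<xi> unfolding hyp_metric_def inner_complex_def
    by (simp add: add_divide_distrib[symmetric]) (simp add: algebra_simps)
  have tr: "(\<Sum>e\<in>Basis. lie_metric \<xi> z (Im z *\<^sub>R e) (Im z *\<^sub>R e)) / 2 * hyp_metric z u v =
      - 2 * (u \<bullet> v) * Im (\<xi> z) / Im z ^ 3 + 2 * Re a * (u \<bullet> v) / (Im z)\<^sup>2" for u v
    unfolding sum_Basis_complex lie hyp_metric_def using assms(1)
    by (simp add: inner_complex_def field_simps power2_eq_square power3_eq_cube)
  have trf: "trace_free_part (lie_metric \<xi>) z u v = Re (2 * cnj b / (Im z)\<^sup>2 * u * v)" for u v
  proof -
    have "trace_free_part (lie_metric \<xi>) z u v = 2 * Re (cnj b * u * v) / (Im z)\<^sup>2"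
      unfolding trace_free_part_def tr unfolding lie
      by (simp add: add_divide_distrib distrib_left mult.assoc)
    also have "\<dots> = Re ((2 / (Im z)\<^sup>2) *\<^sub>R (cnj b * u * v))"
      by (simp only: scaleR_complex.sel times_divide_eq_left)
    finally show ?thesis
      by (simp only: scaleR_conv_of_real) (simp add: mult.assoc)
  qed
  have uniq: "h = k" if "\<forall>u v. Re (k * u * v) = Re (h * u * v)" for h k
    using that[THEN spec[of _ 1], THEN spec[of _ 1]] that[THEN spec[of _ 1], THEN spec[of _ \<i>]]
    by (simp add: complex_eq_iff)
  show ?thesis
    unfolding lie_metric_20_def trf using uniq by (intro the_equality) blast+
qed


subsection \<open>Boundary values\<close>

text \<open>Mean value inequality along a vertical ray, with a majorant depending on the height
  alone. It is applied with \<open>g\<close> a multiple of \<open>y + 2 * sqrt y\<close>, of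
  \<open>- 1 / y\<close> and of \<open>ln y\<close>.\<close>

lemma norm_vertical_increment_le:
  fixes h :: "complex \<Rightarrow> complex" and g g' :: "real \<Rightarrow> real"
  assumes z: "0 < Im z" and s: "0 \<le> s"
    and h: "\<And>w. 0 < Im w \<Longrightarrow> (h has_derivative h' w) (at w)"
    and g: "\<And>y. 0 < y \<Longrightarrow> (g has_real_derivative g' y) (at y)"
    and le: "\<And>r. 0 \<le> r \<Longrightarrow> r \<le> s \<Longrightarrow> norm (h' (z + \<i> * of_real r) \<i>) \<le> g' (Im z + r)"
  shows "norm (h (z + \<i> * of_real s) - h z) \<le> g (Im z + s) - g (Im z)"
proof (cases "s = 0")
  case False
  have dh: "((\<lambda>r. h (z + \<i> * of_real r)) has_vector_derivative h' (z + \<i> * of_real r) \<i>) (at r)"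
    if "0 \<le> r" for r
  proof -
    have "((\<lambda>r. z + \<i> * of_real r) has_derivative (\<lambda>x. x *\<^sub>R \<i>)) (at r)"
      by (auto intro!: derivative_eq_intros simp: scaleR_conv_of_real)
    moreover have "(h has_derivative h' (z + \<i> * of_real r)) (at (z + \<i> * of_real r))"
      using that z by (intro h) simp
    ultimately have "((\<lambda>r. h (z + \<i> * of_real r)) has_derivative (\<lambda>x. h' (z + \<i> * of_real r) (x *\<^sub>R \<i>))) (at r)"
      by (rule has_derivative_compose)
    moreover have "linear (h' (z + \<i> * of_real r))"
      using \<open>(h has_derivative h' (z + \<i> * of_real r)) (at (z + \<i> * of_real r))\<close> has_derivative_linear by blast
    ultimately show ?thesis
      by (simp add: has_vector_derivative_def linear_scale)
  qed
  have dg: "((\<lambda>r. g (Im z + r)) has_vector_derivative g' (Im z + r)) (at r)" if "0 \<le> r" for r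
  proof -
    have "(g has_real_derivative g' (r + Im z)) (at (r + Im z))"
      using that z by (intro g) simp
    then show ?thesis
      unfolding has_real_derivative_iff_has_vector_derivative[symmetric]
      by (simp add: DERIV_shift add.commute)
  qed
  have "norm (h (z + \<i> * of_real s) - h (z + \<i> * of_real 0)) \<le> g (Im z + s) - g (Im z + 0)"
  proof (rule differentiable_bound_general[of 0 s _ _ "\<lambda>r. h' (z + \<i> * of_real r) \<i>" "\<lambda>r. g' (Im z + r)"])
    show "continuous_on {0..s} (\<lambda>r. h (z + \<i> * of_real r))"
      by (intro continuous_at_imp_continuous_on ballI has_vector_derivative_continuous[OF dh]) simp
    show "continuous_on {0..s} (\<lambda>r. g (Im z + r))"
      by (intro continuous_at_imp_continuous_on ballI has_vector_derivative_continuous[OF dg]) simp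
  qed (use s False dh dg le in auto)
  then show ?thesis by simp
qed auto

text \<open>A gradient bound with an integrable singularity \<open>(Im z)\<^bsup>-1/2\<^esup>\<close> makes the vertical limits
  uniform on bounded sets.\<close>

lemma half_plane_extension:
  fixes P :: "complex \<Rightarrow> complex"
  assumes P: "\<And>z. 0 < Im z \<Longrightarrow> (P has_derivative P' z) (at z)"
    and bound: "\<And>z v. 0 < Im z \<Longrightarrow>
      norm (P' z v) \<le> K * sqrt (1 + norm z) * (1 + 1 / sqrt (Im z)) * norm v"
    and K: "0 \<le> K"
  obtains \<xi> C where "continuous_on {z. 0 \<le> Im z} \<xi>"
    and "\<And>z. 0 < Im z \<Longrightarrow> \<xi> z = P z"
    and "\<And>z. 0 \<le> Im z \<Longrightarrow> norm (\<xi> z) \<le> C * ((1 + norm z) * sqrt (1 + norm z))"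
    and "\<And>z. 0 \<le> Im z \<Longrightarrow> ((\<lambda>s. P (z + \<i> * of_real s)) \<longlongrightarrow> \<xi> z) (at_right 0)"
proof -
  \<comment> \<open>The 2 leaves room for climbing by at most 1 above \<open>z\<close>.\<close>
  define M where "M z = K * sqrt (2 + norm z)" for z :: complex
  have M0: "0 \<le> M z" for z
    using K by (simp add: M_def)
  \<comment> \<open>The majorant integrates to \<open>y + 2 * sqrt y\<close>; subadditivity of
    \<open>sqrt\<close> bounds its increment independently of \<open>Im z\<close>, hence uniformly
    down to the real line.\<close>
  have vert: "norm (P (z + \<i> * of_real b) - P (z + \<i> * of_real a)) \<le> M z * (b + 2 * sqrt b)"
    if z: "0 \<le> Im z" and ab: "0 < a" "a \<le> b" "b \<le> 1" for z a b
  proof -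
    define w where "w = z + \<i> * of_real a"
    have Imw: "Im w = Im z + a" by (simp add: w_def)
    have "norm (P (w + \<i> * of_real (b - a)) - P w)
      \<le> M z * (Im w + (b - a) + 2 * sqrt (Im w + (b - a))) - M z * (Im w + 2 * sqrt (Im w))"
    proof (rule norm_vertical_increment_le[where h' = P' and g' = "\<lambda>y. M z * (1 + 1 / sqrt y)"])
      show "((\<lambda>y. M z * (y + 2 * sqrt y)) has_real_derivative M z * (1 + 1 / sqrt y)) (at y)"
        if "0 < y" for y
        using that by (auto intro!: derivative_eq_intros simp: field_simps)
      show "norm (P' (w + \<i> * of_real r) \<i>) \<le> M z * (1 + 1 / sqrt (Im w + r))"
        if r: "0 \<le> r" "r \<le> b - a" for r
      proof -
        have "norm (w + \<i> * of_real r) = norm (z + \<i> * of_real (a + r))"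
          by (simp add: w_def algebra_simps)
        also have "\<dots> \<le> norm z + norm (\<i> * complex_of_real (a + r))"
          by (rule norm_triangle_ineq)
        also have "norm (\<i> * complex_of_real (a + r)) = a + r"
          using ab r by (simp only: norm_mult norm_of_real) simp
        finally have n: "sqrt (1 + norm (w + \<i> * of_real r)) \<le> sqrt (2 + norm z)"
          using ab r by simp
        have "norm (P' (w + \<i> * of_real r) \<i>) \<le>
            K * sqrt (1 + norm (w + \<i> * of_real r)) * (1 + 1 / sqrt (Im (w + \<i> * of_real r))) * norm \<i>"
          using z ab r by (intro bound) (simp add: Imw)
        also have "\<dots> \<le> M z * (1 + 1 / sqrt (Im w + r))"
          unfolding M_def using K n z ab r Imw by (simp add: mult_right_mono mult_left_mono)
        finally show ?thesis .
      qed
    qed (use P z ab Imw in auto)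
    also have "\<dots> = M z * ((b - a) + 2 * (sqrt (Im z + b) - sqrt (Im z + a)))"
      by (simp add: Imw algebra_simps)
    also have "\<dots> \<le> M z * (b + 2 * sqrt b)"
    proof -
      have "sqrt (Im z + b) \<le> sqrt (Im z) + sqrt b"
        using z ab by (intro sqrt_add_le_add_sqrt) auto
      also have "\<dots> \<le> sqrt (Im z + a) + sqrt b"
        using ab by simp
      finally have "(b - a) + 2 * (sqrt (Im z + b) - sqrt (Im z + a)) \<le> b + 2 * sqrt b"
        using ab(1) by (simp add: algebra_simps)
      then show ?thesis
        by (rule mult_left_mono[OF _ M0])
    qed
    finally show ?thesis by (simp add: w_def algebra_simps)
  qed
  define \<delta> where "\<delta> n = 1 / real (Suc n)" for n
  have \<delta>: "0 < \<delta> n" "\<delta> n \<le> 1" for n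
    by (auto simp: \<delta>_def)
  have \<delta>_mono: "\<delta> n \<le> \<delta> N" if "N \<le> n" for n N
    using that by (simp add: \<delta>_def frac_le)
  have \<delta>_lim: "\<delta> \<longlonglongrightarrow> 0"
    unfolding \<delta>_def by (rule LIMSEQ_Suc[OF lim_1_over_n])
  \<comment> \<open>A sequence of heights lets completeness produce the limit; \<open>near\<close>
    then gives convergence for all small heights, with a rate.\<close>
  define \<xi> where "\<xi> z = lim (\<lambda>n. P (z + \<i> * of_real (\<delta> n)))" for z
  have small: "((\<lambda>s. M z * (s + 2 * sqrt s)) \<longlongrightarrow> 0) (at_right 0)" for z
    by (auto intro!: tendsto_eq_intros)
  have conv: "(\<lambda>n. P (z + \<i> * of_real (\<delta> n))) \<longlonglongrightarrow> \<xi> z" if z: "0 \<le> Im z" for z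
  proof -
    have "Cauchy (\<lambda>n. P (z + \<i> * of_real (\<delta> n)))"
    proof (rule metric_CauchyI)
      fix e :: real assume "0 < e"
      have "(\<lambda>n. M z * (\<delta> n + 2 * sqrt (\<delta> n))) \<longlonglongrightarrow> M z * (0 + 2 * sqrt 0)"
        by (intro tendsto_intros \<delta>_lim)
      then have "\<forall>\<^sub>F n in sequentially. M z * (\<delta> n + 2 * sqrt (\<delta> n)) < e / 2"
        using \<open>0 < e\<close> by (intro order_tendstoD(2)) auto
      then obtain N where N: "M z * (\<delta> N + 2 * sqrt (\<delta> N)) < e / 2"
        by (auto simp: eventually_sequentially)
      have "dist (P (z + \<i> * of_real (\<delta> n))) (P (z + \<i> * of_real (\<delta> N))) < e / 2"
        if "N \<le> n" for n
        using vert[OF z \<delta>(1) \<delta>_mono[OF that] \<delta>(2)] N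
        by (simp add: dist_norm norm_minus_commute)
      then show "\<exists>N. \<forall>m\<ge>N. \<forall>n\<ge>N. dist (P (z + \<i> * of_real (\<delta> m)))
          (P (z + \<i> * of_real (\<delta> n))) < e"
        by (meson dist_triangle_half_l)
    qed
    then show ?thesis
      by (simp add: \<xi>_def Cauchy_convergent convergent_LIMSEQ_iff[symmetric])
  qed
  have near: "norm (P (z + \<i> * of_real b) - \<xi> z) \<le> M z * (b + 2 * sqrt b)"
    if z: "0 \<le> Im z" and b: "0 < b" "b \<le> 1" for z b
  proof -
    obtain N where N: "\<delta> N < b"
      using b(1) nat_approx_posE unfolding \<delta>_def by blast
    have "norm (P (z + \<i> * of_real b) - P (z + \<i> * of_real (\<delta> n))) \<le> M z * (b + 2 * sqrt b)"
      if "N \<le> n" for n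
      using \<delta>_mono[OF that] N by (intro vert z b \<delta>) linarith
    moreover have "(\<lambda>n. norm (P (z + \<i> * of_real b) - P (z + \<i> * of_real (\<delta> n))))
        \<longlonglongrightarrow> norm (P (z + \<i> * of_real b) - \<xi> z)"
      by (intro tendsto_intros conv z)
    ultimately show ?thesis
      by (intro Lim_bounded[where M = N]) auto
  qed
  have lim: "((\<lambda>s. P (z + \<i> * of_real s)) \<longlongrightarrow> \<xi> z) (at_right 0)" if z: "0 \<le> Im z" for z
  proof (rule Lim_transform_bound[OF _ small, THEN Lim_null[THEN iffD2]])
    show "\<forall>\<^sub>F s in at_right 0. norm (P (z + \<i> * of_real s) - \<xi> z) \<le> norm (M z * (s + 2 * sqrt s))"
      by (auto simp: eventually_at_right[OF zero_less_one] intro!: exI[of _ 1] order_trans[OF near[OF z]])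
  qed
  have ext: "\<xi> z = P z" if z: "0 < Im z" for z
  proof (rule tendsto_unique[OF _ lim])
    have "isCont P (z + \<i> * of_real 0)"
      using has_derivative_continuous[OF P[OF z]] by simp
    then have "((\<lambda>s. P (z + \<i> * of_real s)) \<longlongrightarrow> P (z + \<i> * of_real 0)) (at_right 0)"
      by (rule isCont_tendsto_compose) (intro tendsto_intros)
    then show "((\<lambda>s. P (z + \<i> * of_real s)) \<longlongrightarrow> P z) (at_right 0)" by simp
  qed (use z in auto)
  have cont: "continuous_on {z. 0 \<le> Im z} \<xi>"
  proof -
    \<comment> \<open>The rate contains \<open>M z\<close>, which grows with \<open>norm z\<close>,
      so the convergence is uniform on balls only; continuity is localised afterwards.\<close>
    have "continuous_on ({z. 0 \<le> Im z} \<inter> ball 0 R) \<xi>" for R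
    proof (rule uniform_limit_theorem[where f = "\<lambda>s z. P (z + \<i> * of_real s)" and F = "at_right 0"])
      show "\<forall>\<^sub>F s in at_right 0. continuous_on ({z. 0 \<le> Im z} \<inter> ball 0 R) (\<lambda>z. P (z + \<i> * of_real s))"
        using eventually_at_right_less[of 0]
      proof eventually_elim
        case (elim s)
        have "continuous_on {w. 0 < Im w} P"
          using P by (intro continuous_at_imp_continuous_on) (auto intro: has_derivative_continuous)
        then show ?case
          by (rule continuous_on_compose2) (use elim in \<open>auto intro!: continuous_intros\<close>)
      qed
      show "uniform_limit ({z. 0 \<le> Im z} \<inter> ball 0 R) (\<lambda>s z. P (z + \<i> * of_real s)) \<xi> (at_right 0)"
      proof (rule uniform_limitI)
        fix e :: real assume "0 < e"
        then have "\<forall>\<^sub>F s in at_right 0. M (of_real R) * (s + 2 * sqrt s) < e"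
          by (rule order_tendstoD(2)[OF small])
        moreover have "\<forall>\<^sub>F s in at_right 0. s < (1::real)"
          by (auto simp: eventually_at_right[OF zero_less_one] intro!: exI[of _ 1])
        ultimately show "\<forall>\<^sub>F s in at_right 0. \<forall>z\<in>{z. 0 \<le> Im z} \<inter> ball 0 R. dist (P (z + \<i> * of_real s)) (\<xi> z) < e"
          using eventually_at_right_less[of 0]
        proof eventually_elim
          case (elim s)
          show ?case
          proof
            fix z assume z: "z \<in> {z. 0 \<le> Im z} \<inter> ball 0 R"
            have "M z * (s + 2 * sqrt s) \<le> M (of_real R) * (s + 2 * sqrt s)"
              unfolding M_def using elim z K by (intro mult_right_mono mult_left_mono) auto
            with near[of z s] elim z show "dist (P (z + \<i> * of_real s)) (\<xi> z) < e"
              by (auto simp: dist_norm)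
          qed
        qed
      qed
    qed (simp add: trivial_limit_at_right_real)
    then have "continuous (at z within {z. 0 \<le> Im z} \<inter> ball 0 (norm z + 1)) \<xi>" if "0 \<le> Im z" for z
      using that by (auto simp: continuous_on_eq_continuous_within)
    moreover have "at z within {z. 0 \<le> Im z} \<inter> ball 0 (norm z + 1) = at z within {z. 0 \<le> Im z}" for z :: complex
      by (rule at_within_nhd[of _ "ball 0 (norm z + 1)"]) auto
    ultimately show ?thesis
      by (auto simp: continuous_on_eq_continuous_within)
  qed
  have growth: "norm (\<xi> z) \<le> (6 * K + norm (P \<i>)) * ((1 + norm z) * sqrt (1 + norm z))" if z: "0 \<le> Im z" for z
  proof -
    define T where "T = 1 + norm z"
    have T: "1 \<le> T" by (simp add: T_def)
    have sT: "1 \<le> sqrt T" using T by simp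
    have MT: "M z \<le> 2 * K * sqrt T"
    proof -
      have "2 + norm z \<le> 4 * T"
        using norm_ge_zero[of z] by (simp add: T_def)
      then have "sqrt (2 + norm z) \<le> sqrt (4 * T)"
        by (rule real_sqrt_le_mono)
      also have "\<dots> = 2 * sqrt T" by (simp add: real_sqrt_mult)
      finally show ?thesis using K by (simp add: M_def mult_left_mono mult.assoc mult.left_commute)
    qed
    have "norm (P (z + \<i>) - \<xi> z) \<le> M z * 3"
      using near[OF z, of 1] by simp
    \<comment> \<open>After the climb from \<open>z\<close> to \<open>z + \<i>\<close>, the way to
      \<open>\<i>\<close> has length \<open>norm z\<close> and stays at height at least 1, where the
      gradient is at most \<open>2 * M z\<close>.\<close>
    moreover have "norm (P (z + \<i>) - P \<i>) \<le> (M z * 2) * norm ((z + \<i>) - \<i>)"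
    proof (rule differentiable_bound[of "{w. 1 \<le> Im w} \<inter> cball 0 T" _ P'])
      show "convex ({w. 1 \<le> Im w} \<inter> cball 0 T)"
        by (intro convex_Int convex_halfspace_Im_ge convex_cball)
      show "(P has_derivative P' w) (at w within {w. 1 \<le> Im w} \<inter> cball 0 T)"
        if "w \<in> {w. 1 \<le> Im w} \<inter> cball 0 T" for w
        using that by (intro has_derivative_at_withinI[OF P]) auto
      show "onorm (P' w) \<le> M z * 2" if w: "w \<in> {w. 1 \<le> Im w} \<inter> cball 0 T" for w
      proof (rule onorm_le)
        fix v
        have "norm (P' w v) \<le> K * sqrt (1 + norm w) * (1 + 1 / sqrt (Im w)) * norm v"
          using w by (intro bound) auto
        also have "\<dots> \<le> K * sqrt (2 + norm z) * 2 * norm v"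
          using w K by (intro mult_right_mono mult_mono mult_left_mono) (auto simp: T_def)
        finally show "norm (P' w v) \<le> M z * 2 * norm v"
          by (simp add: M_def)
      qed
      show "z + \<i> \<in> {w. 1 \<le> Im w} \<inter> cball 0 T"
        using z norm_triangle_ineq[of z \<i>] by (auto simp: T_def)
      show "\<i> \<in> {w. 1 \<le> Im w} \<inter> cball 0 T"
        using T by auto
    qed
    moreover have "norm (\<xi> z) \<le> norm (P (z + \<i>) - \<xi> z) + norm (P (z + \<i>) - P \<i>) + norm (P \<i>)"
      using norm_triangle_ineq4[of "P (z + \<i>)" "P (z + \<i>) - \<xi> z"]
        norm_triangle_ineq[of "P (z + \<i>) - P \<i>" "P \<i>"] by simp
    ultimately have "norm (\<xi> z) \<le> M z * 3 + M z * 2 * norm z + norm (P \<i>)"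
      by simp
    also have "\<dots> = M z * (1 + 2 * T) + norm (P \<i>)"
      by (simp add: T_def algebra_simps)
    also have "\<dots> \<le> (2 * K * sqrt T) * (3 * T) + norm (P \<i>) * (T * sqrt T)"
    proof (rule add_mono)
      show "M z * (1 + 2 * T) \<le> (2 * K * sqrt T) * (3 * T)"
        using MT T K M0[of z] by (intro mult_mono) auto
      have "1 \<le> T * sqrt T" using mult_mono[OF T sT] T by simp
      then show "norm (P \<i>) \<le> norm (P \<i>) * (T * sqrt T)"
        using mult_left_mono[of 1 "T * sqrt T" "norm (P \<i>)"] by simp
    qed
    also have "\<dots> = (6 * K + norm (P \<i>)) * (T * sqrt T)"
      by (simp add: algebra_simps)
    finally show ?thesis by (simp add: T_def)
  qed
  show ?thesis
    using that cont ext growth lim by blast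
qed


subsection \<open>Primitives of the differential\<close>

text \<open>Iterated primitives of the differential, normalised so that \<open>F1\<close> vanishes at infinity and the
  affine correction of \<open>\<xi>\<^sub>c\<close> at \<open>\<i>\<close> is already incorporated.\<close>

locale bounded_differential =
  fixes f F1 F2 F3 :: "complex \<Rightarrow> complex" and D :: real
  assumes holo: "f holomorphic_on upper_half_plane"
    and D_pos: "0 < D"
    and f_bound: "0 < Im z \<Longrightarrow> norm (f z) \<le> D / (Im z)\<^sup>2"
    and F1: "0 < Im z \<Longrightarrow> (F1 has_field_derivative f z) (at z)"
    and F1_bound: "0 < Im z \<Longrightarrow> norm (F1 z) \<le> D / Im z"
    and F2: "0 < Im z \<Longrightarrow> (F2 has_field_derivative F1 z) (at z)"
    and F3: "0 < Im z \<Longrightarrow> (F3 has_field_derivative F2 z) (at z)"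
    and F2_i: "F2 \<i> = 2 * \<i> * F1 \<i>"
    and F3_i: "F3 \<i> = 2 * F1 \<i> + 2 * \<i> * F2 \<i>"

lemma upper_half_plane_primitive:
  fixes f :: "complex \<Rightarrow> complex" and c :: complex
  assumes "f holomorphic_on upper_half_plane"
  obtains F where "\<And>z. 0 < Im z \<Longrightarrow> (F has_field_derivative f z) (at z)" "F \<i> = c"
proof -
  obtain g where g: "\<And>z. z \<in> upper_half_plane \<Longrightarrow> (g has_field_derivative f z) (at z within upper_half_plane)"
    using holomorphic_convex_primitive'[OF convex_upper_half_plane open_upper_half_plane assms] by blast
  have "((\<lambda>w. g w + (c - g \<i>)) has_field_derivative f z) (at z)" if "0 < Im z" for z
    using g[of z] that at_within_open[OF _ open_upper_half_plane, of z]
    by (auto intro!: derivative_eq_intros)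
  moreover have "g \<i> + (c - g \<i>) = c"
    by (simp add: algebra_simps)
  ultimately show ?thesis
    by (rule that)
qed

lemma holomorphic_on_upper_half_planeI:
  "(\<And>z. 0 < Im z \<Longrightarrow> (F has_field_derivative f z) (at z)) \<Longrightarrow> F holomorphic_on upper_half_plane"
  by (rule holomorphic_onI)
     (auto simp: field_differentiable_def intro: has_field_derivative_at_within)

text \<open>Cauchy's estimate on the disc of radius \<open>Im z / 2\<close>, all of whose points
  have height at least \<open>Im z / 2\<close>; hence the factor 8.\<close>

lemma norm_deriv_upper_half_plane_le:
  assumes "f holomorphic_on upper_half_plane" "0 < Im z"
    and bound: "\<And>w. 0 < Im w \<Longrightarrow> norm (f w) \<le> D / (Im w)\<^sup>2" and "0 < D"
  shows "norm (deriv f z) \<le> 8 * D / Im z ^ 3"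
proof -
  define r where "r = Im z / 2"
  have r: "0 < r" using assms(2) by (simp add: r_def)
  have Im_ge: "r \<le> Im w" if "w \<in> cball z r" for w
    using abs_Im_le_cmod[of "z - w"] that by (auto simp: dist_norm r_def)
  have sub: "cball z r \<subseteq> upper_half_plane"
    using Im_ge r by force
  have "norm ((deriv ^^ 1) f z) \<le> fact 1 * (D / r\<^sup>2) / r ^ 1"
  proof (rule Cauchy_inequality)
    show "f holomorphic_on ball z r"
      using assms(1) sub ball_subset_cball holomorphic_on_subset by blast
    show "continuous_on (cball z r) f"
      using assms(1) sub holomorphic_on_imp_continuous_on holomorphic_on_subset by blast
    show "norm (f w) \<le> D / r\<^sup>2" if "norm (z - w) = r" for w
    proof -
      have "r \<le> Im w"
        using that by (intro Im_ge) (simp add: dist_norm)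
      then have "D / (Im w)\<^sup>2 \<le> D / r\<^sup>2"
        using r \<open>0 < D\<close> by (intro divide_left_mono power_mono mult_pos_pos) auto
      with bound[of w] \<open>r \<le> Im w\<close> r show ?thesis by linarith
    qed
  qed (rule r)
  also have "fact 1 * (D / r\<^sup>2) / r ^ 1 = 8 * D / Im z ^ 3"
    using assms(2) by (simp add: r_def field_simps power2_eq_square power3_eq_cube)
  finally show ?thesis by simp
qed

text \<open>Since \<open>D / y\<^sup>2\<close> is integrable towards infinity, any primitive of
  \<open>f\<close> converges along the imaginary axis. Subtracting the limit gives
  \<open>F1\<close>, and its bound \<open>D / Im z\<close> is the tail of that integral.\<close>

lemma bounded_differential_exists:
  assumes holo: "f holomorphic_on upper_half_plane" and D: "0 < D"
    and bound: "\<And>z. 0 < Im z \<Longrightarrow> norm (f z) \<le> D / (Im z)\<^sup>2"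
  obtains F1 F2 F3 where "bounded_differential f F1 F2 F3 D"
proof -
  obtain G where G: "\<And>z. 0 < Im z \<Longrightarrow> (G has_field_derivative f z) (at z)"
    using upper_half_plane_primitive[OF holo] by metis
  have vert: "norm (G (z + \<i> * of_real s) - G z) \<le> D / Im z" if z: "0 < Im z" "0 \<le> s" for z s
  proof -
    have "norm (G (z + \<i> * of_real s) - G z) \<le> (- D / (Im z + s)) - (- D / Im z)"
    proof (rule norm_vertical_increment_le[where h' = "\<lambda>w v. f w * v" and g' = "\<lambda>y. D / y\<^sup>2"])
      show "((\<lambda>y. - D / y) has_real_derivative D / y\<^sup>2) (at y)" if "0 < y" for y
        using that by (auto intro!: derivative_eq_intros simp: power2_eq_square)
      show "norm (f (z + \<i> * of_real r) * \<i>) \<le> D / (Im z + r)\<^sup>2" if "0 \<le> r" for r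
        using bound[of "z + \<i> * of_real r"] z that by (simp add: norm_mult)
    qed (use z G in \<open>auto simp: has_field_derivative_def\<close>)
    also have "\<dots> \<le> D / Im z" using z D by simp
    finally show ?thesis .
  qed
  define a where "a n = G (\<i> * of_real (real (Suc n)))" for n
  have "Cauchy a"
  proof (rule metric_CauchyI)
    fix e :: real assume e: "0 < e"
    obtain N :: nat where N: "2 * D / e < real N"
      using reals_Archimedean2 by blast
    have "dist (a n) (a N) < e / 2" if "N \<le> n" for n
    proof -
      have "a n = G (\<i> * of_real (real (Suc N)) + \<i> * of_real (real n - real N))"
        by (simp add: a_def algebra_simps)
      then have "dist (a n) (a N) \<le> D / real (Suc N)"
        using vert[of "\<i> * of_real (real (Suc N))" "real n - real N"] that
        by (simp add: a_def dist_norm)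
      also have "D / real (Suc N) < e / 2"
        using N e by (simp add: field_simps)
      finally show ?thesis .
    qed
    then show "\<exists>M. \<forall>m\<ge>M. \<forall>n\<ge>M. dist (a m) (a n) < e"
      by (meson dist_triangle_half_l)
  qed
  then obtain L where L: "a \<longlonglongrightarrow> L"
    using Cauchy_convergent convergent_def by blast
  define F1 where "F1 z = G z - L" for z
  have F1: "(F1 has_field_derivative f z) (at z)" if "0 < Im z" for z
    unfolding F1_def using G[OF that] by (auto intro!: derivative_eq_intros)
  have F1_bound: "norm (F1 z) \<le> D / Im z" if z: "0 < Im z" for z
  proof -
    define w where "w n = z + \<i> * of_real (real (Suc n))" for n
    \<comment> \<open>The limit along the imaginary axis is also the limit above \<open>z\<close>:
      the displacement by \<open>z\<close> at height at least \<open>n + 1\<close> costs at most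
      \<open>D * norm z / (n + 1)\<^sup>2\<close>.\<close>
    have "(\<lambda>n. G (w n) - a n) \<longlonglongrightarrow> 0"
    proof (rule Lim_null_comparison)
      show "\<forall>\<^sub>F n in sequentially. norm (G (w n) - a n) \<le> D * norm z * (1 / real (Suc n))"
      proof (rule always_eventually, rule allI)
        fix n
        have "norm (G (w n) - G (\<i> * of_real (real (Suc n)))) \<le> D / (real (Suc n))\<^sup>2 * norm (w n - \<i> * of_real (real (Suc n)))"
        proof (rule field_differentiable_bound[of "{u. real (Suc n) \<le> Im u}"])
          show "convex {u. real (Suc n) \<le> Im u}" by (rule convex_halfspace_Im_ge)
          show "(G has_field_derivative f u) (at u within {u. real (Suc n) \<le> Im u})"
            if "u \<in> {u. real (Suc n) \<le> Im u}" for u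
            using that by (intro has_field_derivative_at_within[OF G]) auto
          show "norm (f u) \<le> D / (real (Suc n))\<^sup>2" if "u \<in> {u. real (Suc n) \<le> Im u}" for u
          proof -
            have "D / (Im u)\<^sup>2 \<le> D / (real (Suc n))\<^sup>2"
              using that D by (intro divide_left_mono power_mono mult_pos_pos) auto
            with bound[of u] that show ?thesis by auto
          qed
        qed (use z in \<open>auto simp: w_def\<close>)
        also have "\<dots> = D * norm z * (1 / real (Suc n)) * (1 / real (Suc n))"
          by (simp add: w_def power2_eq_square)
        also have "\<dots> \<le> D * norm z * (1 / real (Suc n))"
          using D by (intro mult_left_le) auto
        finally show "norm (G (w n) - a n) \<le> D * norm z * (1 / real (Suc n))"
          by (simp add: a_def)
      qed
      show "(\<lambda>n. D * norm z * (1 / real (Suc n))) \<longlonglongrightarrow> 0"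
        by (rule tendsto_mult_right_zero[OF LIMSEQ_Suc[OF lim_1_over_n]])
    qed
    from tendsto_add[OF this L] have "(\<lambda>n. G (w n)) \<longlonglongrightarrow> L" by simp
    then have "(\<lambda>n. norm (G (w n) - G z)) \<longlonglongrightarrow> norm (L - G z)"
      by (intro tendsto_intros)
    moreover have "norm (G (w n) - G z) \<le> D / Im z" for n
      unfolding w_def by (rule vert[OF z]) simp
    ultimately have "norm (L - G z) \<le> D / Im z"
      by (intro Lim_bounded[where M = 0]) auto
    then show ?thesis by (simp add: F1_def norm_minus_commute)
  qed
  obtain F2 where F2: "\<And>z. 0 < Im z \<Longrightarrow> (F2 has_field_derivative F1 z) (at z)" "F2 \<i> = 2 * \<i> * F1 \<i>"
    using upper_half_plane_primitive[OF holomorphic_on_upper_half_planeI[OF F1]] by metis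
  obtain F3 where F3: "\<And>z. 0 < Im z \<Longrightarrow> (F3 has_field_derivative F2 z) (at z)"
      "F3 \<i> = 2 * F1 \<i> + 2 * \<i> * F2 \<i>"
    using upper_half_plane_primitive[OF holomorphic_on_upper_half_planeI[OF F2(1)]] by metis
  have "bounded_differential f F1 F2 F3 D"
    by unfold_locales (use holo D bound F1 F1_bound F2 F3 in auto)
  then show ?thesis
    by (rule that)
qed

context bounded_differential
begin

text \<open>\<open>S\<close> comes from integrating \<open>\<i> \<zeta>\<^sup>2 f(w)\<close> by parts in \<open>\<zeta>\<close> along \<open>w = cnj z + 2 \<i> \<zeta>\<close>.\<close>

definition S :: "real \<Rightarrow> complex \<Rightarrow> complex" where
  "S s w = (of_real s)\<^sup>2 / 2 * F1 w + \<i> * of_real s / 2 * F2 w - F3 w / 4"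

definition S1 :: "real \<Rightarrow> complex \<Rightarrow> complex" where
  "S1 s w = (of_real s)\<^sup>2 / 2 * f w + \<i> * of_real s / 2 * F1 w - F2 w / 4"

definition S2 :: "real \<Rightarrow> complex \<Rightarrow> complex" where
  "S2 s w = (of_real s)\<^sup>2 / 2 * deriv f w + \<i> * of_real s / 2 * f w - F1 w / 4"

text \<open>The boundary term at the lower limit \<open>\<zeta> = Im z\<close>, where
  \<open>cnj z + 2 * \<i> * \<zeta>\<close> equals \<open>z\<close>.\<close>

definition P :: "complex \<Rightarrow> complex" where
  "P z = cnj (S (Im z) z)"

text \<open>\<open>A\<close> and \<open>B\<close> are the Wirtinger derivatives of \<open>P\<close>
  with respect to \<open>z\<close> and \<open>cnj z\<close>.\<close>

definition A :: "complex \<Rightarrow> complex" where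
  "A z = cnj (\<i> * of_real (Im z) / 2 * F1 z - F2 z / 4)"

definition B :: "complex \<Rightarrow> complex" where
  "B z = (of_real (Im z))\<^sup>2 / 2 * cnj (f z)"

section \<open>Derivatives and harmonicity of \<open>P\<close>\<close>

lemma deriv_f: "0 < Im z \<Longrightarrow> (f has_field_derivative deriv f z) (at z)"
  using holomorphic_derivI[OF holo open_upper_half_plane] by simp

lemma S_deriv: "0 < Im w \<Longrightarrow> (S s has_field_derivative S1 s w) (at w)"
  unfolding S_def S1_def by (auto intro!: derivative_eq_intros F1 F2 F3 simp: algebra_simps)

lemma S1_deriv: "0 < Im w \<Longrightarrow> (S1 s has_field_derivative S2 s w) (at w)"
  unfolding S1_def S2_def by (auto intro!: derivative_eq_intros F1 F2 deriv_f simp: algebra_simps)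

text \<open>\<open>F3_i\<close> is this equation solved for \<open>F3 \<i>\<close>, just as
  \<open>F2_i\<close> is \<open>A \<i> = 0\<close> solved for \<open>F2 \<i>\<close>. Together they
  make the affine correction of \<open>P\<close> at \<open>\<i>\<close> vanish.\<close>

lemma P_i: "P \<i> = 0"
  by (simp add: P_def S_def F2_i F3_i algebra_simps)

lemma A_i: "A \<i> = 0"
  by (simp add: A_def F2_i)

lemma of_real_Im_deriv: "((\<lambda>z. complex_of_real (Im z)) has_derivative (\<lambda>v. of_real (Im v))) (at z)"
  by (rule bounded_linear_imp_has_derivative[OF bounded_linear_compose[OF bounded_linear_of_real bounded_linear_Im]])

lemma P_deriv:
  assumes "0 < Im z"
  shows "(P has_derivative (\<lambda>v. A z * v + B z * cnj v)) (at z)"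
proof -
  have d: "(F1 has_derivative (\<lambda>v. f z * v)) (at z)" "(F2 has_derivative (\<lambda>v. F1 z * v)) (at z)"
      "(F3 has_derivative (\<lambda>v. F2 z * v)) (at z)"
    using F1[OF assms] F2[OF assms] F3[OF assms] by (auto simp: has_field_derivative_def)
  \<comment> \<open>With \<open>Im v\<close> split this way, the \<open>F1\<close> and
    \<open>F2\<close> terms in the coefficient of \<open>v\<close> cancel before conjugation,
    leaving \<open>(Im z)\<^sup>2 / 2 * f z\<close>; conjugation turns it into \<open>B z\<close>,
    the coefficient of \<open>cnj v\<close>.\<close>
  have Imv: "complex_of_real (Im v) = - (\<i> / 2) * (v - cnj v)" for v
    by (simp add: complex_eq_iff)
  have "((\<lambda>z. cnj (1 / 2 * (of_real (Im z) * of_real (Im z)) * F1 z + \<i> / 2 * of_real (Im z) * F2 z - 1 / 4 * F3 z))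
    has_derivative (\<lambda>v. A z * v + B z * cnj v)) (at z)"
    by (rule has_derivative_cnj derivative_eq_intros d of_real_Im_deriv refl)+
       (simp add: fun_eq_iff A_def B_def Imv[of v for v] field_simps power2_eq_square)
  then show ?thesis
    by (simp add: P_def[abs_def] S_def power2_eq_square)
qed

lemma P_deriv2:
  assumes "0 < Im z"
  shows "((\<lambda>p. A p * v + B p * cnj v) has_derivative
    (\<lambda>h. cnj (\<i> * of_real (Im h) / 2 * F1 z + \<i> * of_real (Im z) / 2 * (f z * h) - F1 z * h / 4) * v
      + (of_real (Im z) * of_real (Im h) * cnj (f z)
         + (of_real (Im z))\<^sup>2 / 2 * cnj (deriv f z * h)) * cnj v)) (at z)"
proof -
  have d: "(F1 has_derivative (\<lambda>v. f z * v)) (at z)" "(F2 has_derivative (\<lambda>v. F1 z * v)) (at z)"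
      "(f has_derivative (\<lambda>v. deriv f z * v)) (at z)"
    using F1[OF assms] F2[OF assms] deriv_f[OF assms] by (auto simp: has_field_derivative_def)
  have "((\<lambda>z. cnj (\<i> / 2 * of_real (Im z) * F1 z - 1 / 4 * F2 z) * v +
      1 / 2 * (of_real (Im z) * of_real (Im z)) * cnj (f z) * cnj v) has_derivative
    (\<lambda>h. cnj (\<i> * of_real (Im h) / 2 * F1 z + \<i> * of_real (Im z) / 2 * (f z * h) - F1 z * h / 4) * v
      + (of_real (Im z) * of_real (Im h) * cnj (f z)
         + (of_real (Im z))\<^sup>2 / 2 * cnj (deriv f z * h)) * cnj v)) (at z)"
    by (rule has_derivative_cnj derivative_eq_intros d of_real_Im_deriv refl)+
       (simp add: fun_eq_iff field_simps power2_eq_square)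
  then show ?thesis
    by (simp add: A_def B_def power2_eq_square)
qed

lemma smooth_P: "smooth_on upper_half_plane P"
proof -
  have alg_Im: "smooth_alg upper_half_plane (\<lambda>z. complex_of_real (Im z))"
    by (rule smooth_alg.base[OF smooth_on_linear[OF bounded_linear_compose[OF bounded_linear_of_real bounded_linear_Im]]])
  have alg: "smooth_alg upper_half_plane F" if "\<And>z. 0 < Im z \<Longrightarrow> (F has_field_derivative g z) (at z)" for F g
    by (rule smooth_alg.base[OF smooth_on_holomorphic[OF holomorphic_on_upper_half_planeI[OF that] open_upper_half_plane]])
  have c: "smooth_alg upper_half_plane (\<lambda>z. c)" for c
    by (rule smooth_alg.base[OF smooth_on_const])
  have "smooth_on upper_half_plane (\<lambda>z. cnj ((1 / 2 * (of_real (Im z) * of_real (Im z)) * F1 z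
      + \<i> / 2 * of_real (Im z) * F2 z) + (- 1 / 4) * F3 z))"
    by (rule smooth_on_alg[OF smooth_alg.linear[OF bounded_linear_cnj
        smooth_alg.add[OF smooth_alg.add[OF
          smooth_alg.mult[OF smooth_alg.mult[OF c smooth_alg.mult[OF alg_Im alg_Im]] alg[OF F1]]
          smooth_alg.mult[OF smooth_alg.mult[OF c alg_Im] alg[OF F2]]] smooth_alg.mult[OF c alg[OF F3]]]]])
  then show ?thesis
    by (rule smooth_on_cong) (simp add: P_def S_def power2_eq_square)
qed

text \<open>The Laplacian of \<open>P\<close> is four times the z-derivative of \<open>B\<close>,
  and the first-order bracket is \<open>2 * B z\<close>. The equation thus says that
  \<open>B z / (Im z)\<^sup>2\<close> has vanishing z-derivative, and this quotient is
  \<open>cnj (f z) / 2\<close>.\<close>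

lemma harmonic_P: "harmonic_vector_field upper_half_plane P"
proof (rule harmonic_vector_fieldI[OF open_upper_half_plane order_refl smooth_P])
  show "(P has_derivative (\<lambda>v. A z * v + B z * cnj v)) (at z)" if "z \<in> upper_half_plane" for z
    using P_deriv that by simp
  show "((\<lambda>p. A p * v + B p * cnj v) has_derivative
    (\<lambda>h. cnj (\<i> * of_real (Im h) / 2 * F1 z + \<i> * of_real (Im z) / 2 * (f z * h) - F1 z * h / 4) * v
      + (of_real (Im z) * of_real (Im h) * cnj (f z)
         + (of_real (Im z))\<^sup>2 / 2 * cnj (deriv f z * h)) * cnj v)) (at z)"
    if "z \<in> upper_half_plane" for z v
    using P_deriv2 that by simp
qed (auto simp: B_def power2_eq_square field_simps)

end


subsection \<open>Estimates and limits\<close>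

context bounded_differential
begin

text \<open>Integrating \<open>D / y\<close> gives a logarithm of the ratio of heights;
  \<open>ln q \<le> 2 * sqrt q\<close> trades it for a power that serves both near the real line and
  far away.\<close>

lemma F2_vertical:
  assumes z: "0 < Im z" and s: "0 \<le> s"
  shows "norm (F2 (z + \<i> * of_real s) - F2 z) \<le> 2 * D * sqrt ((Im z + s) / Im z)"
proof -
  have "norm (F2 (z + \<i> * of_real s) - F2 z) \<le> D * ln (Im z + s) - D * ln (Im z)"
  proof (rule norm_vertical_increment_le[where h' = "\<lambda>w v. F1 w * v" and g' = "\<lambda>y. D / y"])
    show "((\<lambda>y. D * ln y) has_real_derivative D / y) (at y)" if "0 < y" for y
      using that by (auto intro!: derivative_eq_intros)
    show "norm (F1 (z + \<i> * of_real r) * \<i>) \<le> D / (Im z + r)" if "0 \<le> r" for r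
      using F1_bound[of "z + \<i> * of_real r"] z that by (simp add: norm_mult)
  qed (use z s F2 in \<open>auto simp: has_field_derivative_def\<close>)
  also have "\<dots> = D * ln ((Im z + s) / Im z)"
    using z s by (simp add: ln_div right_diff_distrib)
  also have "\<dots> \<le> D * (2 * sqrt ((Im z + s) / Im z))"
  proof (rule mult_left_mono)
    define q where "q = (Im z + s) / Im z"
    have q: "0 < q" using z s by (simp add: q_def)
    have "ln q = 2 * ln (sqrt q)"
      using q by (simp add: ln_sqrt)
    also have "\<dots> \<le> 2 * sqrt q"
      using ln_bound[of "sqrt q"] q by simp
    finally show "ln ((Im z + s) / Im z) \<le> 2 * sqrt ((Im z + s) / Im z)"
      by (simp add: q_def)
  qed (use D_pos in simp)
  finally show ?thesis by (simp add: mult_ac)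
qed

text \<open>Path from \<open>z\<close> up by \<open>T\<close>, across to
  \<open>\<i> + \<i> * T\<close>, and down to \<open>\<i>\<close>. The crossing has length at most
  \<open>T\<close> at heights where \<open>F1\<close> is at most \<open>D / T\<close>, so it costs
  \<open>D\<close>; the vertical legs cost square roots, and only the one at \<open>z\<close> is
  singular at the real line.\<close>

lemma F2_bound:
  assumes z: "0 < Im z"
  shows "norm (F2 z) \<le> (norm (F2 \<i>) + 5 * D) * sqrt (1 + norm z) * (1 + 1 / sqrt (Im z))"
proof -
  define T where "T = 1 + norm z"
  have T: "1 \<le> T" "Im z \<le> T"
    using abs_Im_le_cmod[of z] by (auto simp: T_def)
  have sT: "1 \<le> sqrt T" using T by simp
  have s2: "sqrt (x + T) \<le> 2 * sqrt T" if "x \<le> T" for x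
  proof -
    have "sqrt (x + T) \<le> sqrt (4 * T)"
      using that T by (intro real_sqrt_le_mono) simp
    then show ?thesis by (simp add: real_sqrt_mult)
  qed
  have "norm (F2 (z + \<i> * of_real T) - F2 z) \<le> 2 * D * sqrt ((Im z + T) / Im z)"
    using z T by (intro F2_vertical) auto
  also have "\<dots> \<le> 2 * D * (2 * sqrt T / sqrt (Im z))"
    unfolding real_sqrt_divide using z D_pos s2[OF T(2)]
    by (intro mult_left_mono divide_right_mono) auto
  finally have 1: "norm (F2 (z + \<i> * of_real T) - F2 z) \<le> 4 * D * sqrt T / sqrt (Im z)"
    by simp
  have "norm (F2 (\<i> + \<i> * of_real T) - F2 \<i>) \<le> 2 * D * sqrt ((Im \<i> + T) / Im \<i>)"
    using T by (intro F2_vertical) auto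
  also have "\<dots> \<le> 4 * D * sqrt T"
    using s2[of 1] T D_pos by simp
  finally have 2: "norm (F2 (\<i> + \<i> * of_real T) - F2 \<i>) \<le> 4 * D * sqrt T" .
  have "norm (F2 (z + \<i> * of_real T) - F2 (\<i> + \<i> * of_real T))
      \<le> D / T * norm ((z + \<i> * of_real T) - (\<i> + \<i> * of_real T))"
  proof (rule field_differentiable_bound[of "{u. T \<le> Im u}"])
    show "convex {u. T \<le> Im u}" by (rule convex_halfspace_Im_ge)
    show "(F2 has_field_derivative F1 u) (at u within {u. T \<le> Im u})" if "u \<in> {u. T \<le> Im u}" for u
      using that T by (intro has_field_derivative_at_within[OF F2]) auto
    show "norm (F1 u) \<le> D / T" if "u \<in> {u. T \<le> Im u}" for u
    proof -
      have "D / Im u \<le> D / T"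
        using that T D_pos by (intro divide_left_mono mult_pos_pos) auto
      with F1_bound[of u] that T show ?thesis by auto
    qed
  qed (use z in auto)
  also have "\<dots> \<le> D / T * T"
    using D_pos T norm_triangle_ineq4[of z \<i>] by (intro mult_left_mono) (auto simp: T_def)
  also have "\<dots> = D" using T by simp
  also have "\<dots> \<le> D * sqrt T" using sT D_pos by simp
  finally have 3: "norm (F2 (z + \<i> * of_real T) - F2 (\<i> + \<i> * of_real T)) \<le> D * sqrt T" .
  have eq: "F2 z = F2 \<i> + (F2 (\<i> + \<i> * of_real T) - F2 \<i>)
      + (F2 (z + \<i> * of_real T) - F2 (\<i> + \<i> * of_real T)) - (F2 (z + \<i> * of_real T) - F2 z)"
    by simp
  have norm4: "norm (a + b + c - d) \<le> norm a + norm b + norm c + norm d" for a b c d :: complex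
    by (rule order_trans[OF norm_triangle_ineq4
          add_right_mono[OF order_trans[OF norm_triangle_ineq add_right_mono[OF norm_triangle_ineq]]]])
  have "norm (F2 z) \<le> norm (F2 \<i>) + norm (F2 (\<i> + \<i> * of_real T) - F2 \<i>)
      + norm (F2 (z + \<i> * of_real T) - F2 (\<i> + \<i> * of_real T)) + norm (F2 (z + \<i> * of_real T) - F2 z)"
    using norm4[of "F2 \<i>" "F2 (\<i> + \<i> * of_real T) - F2 \<i>" "F2 (z + \<i> * of_real T) - F2 (\<i> + \<i> * of_real T)"
        "F2 (z + \<i> * of_real T) - F2 z"]
    unfolding eq[symmetric] .
  also have "\<dots> \<le> norm (F2 \<i>) * sqrt T + 4 * D * sqrt T + D * sqrt T + 4 * D * sqrt T / sqrt (Im z)"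
    using 1 2 3 mult_left_mono[OF sT, of "norm (F2 \<i>)"] by simp
  also have "\<dots> \<le> (norm (F2 \<i>) + 5 * D) * sqrt T * (1 + 1 / sqrt (Im z))"
  proof -
    have "4 * D * sqrt T / sqrt (Im z) \<le> (norm (F2 \<i>) + 5 * D) * sqrt T / sqrt (Im z)"
      using D_pos z sT by (intro divide_right_mono mult_right_mono) auto
    then show ?thesis by (simp add: algebra_simps add_divide_distrib)
  qed
  finally show ?thesis by (simp add: T_def)
qed

text \<open>\<open>F2_bound\<close> accounts for \<open>norm (F2 \<i>) + 5 * D\<close>; the last
  \<open>D\<close> is \<open>D / 2\<close> from the \<open>F1\<close> term of \<open>A\<close> plus
  \<open>D / 2\<close> from \<open>B\<close>.\<close>

definition K :: real where
  "K = norm (F2 \<i>) + 6 * D"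

lemma P_gradient_bound:
  assumes z: "0 < Im z"
  shows "norm (A z * v + B z * cnj v) \<le> K * sqrt (1 + norm z) * (1 + 1 / sqrt (Im z)) * norm v"
proof -
  define Q where "Q = sqrt (1 + norm z) * (1 + 1 / sqrt (Im z))"
  have "1 * 1 \<le> sqrt (1 + norm z) * (1 + 1 / sqrt (Im z))"
    using z by (intro mult_mono) auto
  then have Q: "1 \<le> Q" by (simp add: Q_def)
  have "norm (A z) \<le> norm (\<i> * of_real (Im z) / 2 * F1 z) + norm (F2 z / 4)"
    unfolding A_def complex_mod_cnj by (rule norm_triangle_ineq4)
  also have "norm (\<i> * of_real (Im z) / 2 * F1 z) \<le> D / 2"
    using F1_bound[OF z] z by (simp add: norm_mult norm_divide field_simps)
  also have "norm (F2 z / 4) \<le> norm (F2 z)"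
    by (simp add: norm_divide)
  also have "norm (F2 z) \<le> (norm (F2 \<i>) + 5 * D) * Q"
    using F2_bound[OF z] by (simp add: Q_def mult.assoc)
  finally have A: "norm (A z) \<le> D / 2 + (norm (F2 \<i>) + 5 * D) * Q" by simp
  have B: "norm (B z) \<le> D / 2"
    using f_bound[OF z] z by (simp add: B_def norm_mult norm_divide norm_power field_simps)
  have "norm (A z * v + B z * cnj v) \<le> norm (A z) * norm v + norm (B z) * norm v"
    using norm_triangle_ineq[of "A z * v" "B z * cnj v"] by (simp add: norm_mult)
  also have "\<dots> = (norm (A z) + norm (B z)) * norm v"
    by (simp add: algebra_simps)
  also have "\<dots> \<le> (K * Q) * norm v"
  proof (rule mult_right_mono)
    have "D \<le> D * Q" using Q D_pos by simp
    with A B show "norm (A z) + norm (B z) \<le> K * Q"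
      by (simp add: K_def algebra_simps)
  qed simp
  finally show ?thesis by (simp add: Q_def mult.assoc)
qed

text \<open>The bounds on \<open>Im z\<close> keep the path
  \<open>cnj z + 2 * \<i> * \<zeta>\<close> in the half-plane, whichever limit is larger. The point
  \<open>z\<close> may be real, which is how the boundary values are reached.\<close>

lemma xi_integral_eq:
  assumes "0 < a" "0 < b" "Im z < 2 * a" "Im z < 2 * b"
  shows "xi_integral f z a b =
    cnj (S a (cnj z + 2 * \<i> * of_real a) - S b (cnj z + 2 * \<i> * of_real b))"
proof -
  define w where "w x = cnj z + 2 * \<i> * complex_of_real x" for x
  have pos: "0 < Im (w x)" if "min a b \<le> x" for x
    using that assms by (auto simp: w_def min_def split: if_splits)
  have dw: "(w has_vector_derivative 2 * \<i>) (at x within X)" for x X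
    unfolding w_def by (auto intro!: derivative_eq_intros)
  have dF: "((\<lambda>x. F (w x)) has_vector_derivative 2 * \<i> * F') (at x within X)"
    if "(F has_field_derivative F') (at (w x))" for F F' x X
    using field_vector_diff_chain_within[OF dw has_field_derivative_at_within[OF that]]
    by (simp add: o_def)
  have cont: "continuous_on {min a b..max a b} (\<lambda>x. f (w x))"
  proof (rule continuous_on_compose2[OF holomorphic_on_imp_continuous_on[OF holo]])
    show "continuous_on {min a b..max a b} w"
      unfolding w_def by (intro continuous_intros)
  qed (use pos in auto)
  have "(LBINT x=ereal a..ereal b. \<i> * (complex_of_real x)\<^sup>2 * cnj (f (w x)))
     = (- cnj (S b (w b))) - (- cnj (S a (w a)))"
  proof (rule interval_integral_FTC_finite)
    show "continuous_on {min a b..max a b} (\<lambda>x. \<i> * (complex_of_real x)\<^sup>2 * cnj (f (w x)))"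
      by (intro continuous_intros cont)
    fix x assume "min a b \<le> x" "x \<le> max a b"
    then have p: "0 < Im (w x)" by (intro pos)
    have dx: "(complex_of_real has_vector_derivative 1) (at x within X)" for X
      by (auto intro!: derivative_eq_intros)
    \<comment> \<open>By the product rule with \<open>2 * \<i>\<close> as the derivative of
      \<open>w\<close>, the two \<open>F1\<close> terms cancel, and so do the two \<open>F2\<close>
      terms.\<close>
    have "((\<lambda>x. 1 / 2 * (of_real x * of_real x) * F1 (w x) + \<i> / 2 * of_real x * F2 (w x) - 1 / 4 * F3 (w x))
        has_vector_derivative \<i> * (of_real x)\<^sup>2 * f (w x)) (at x within {min a b..max a b})"
      by (rule derivative_eq_intros has_vector_derivative_mult has_vector_derivative_mult_right dx dF[OF F1[OF p]] dF[OF F2[OF p]] dF[OF F3[OF p]] refl)+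
         (simp add: algebra_simps power2_eq_square)
    from has_vector_derivative_minus[OF has_vector_derivative_cnj[OF this]]
    show "((\<lambda>x. - cnj (S x (w x))) has_vector_derivative \<i> * (complex_of_real x)\<^sup>2 * cnj (f (w x)))
        (at x within {min a b..max a b})"
      by (simp add: S_def power2_eq_square)
  qed
  then show ?thesis
    by (simp add: xi_integral_def w_def)
qed

section \<open>The truncated fields and their normalised limit\<close>

lemma xi_c_eq:
  assumes "0 < Im z" "Im z < c"
  shows "xi_c f c z = P z - cnj (S c (cnj z + 2 * \<i> * of_real c))"
proof -
  have "cnj z + 2 * \<i> * of_real (Im z) = z"
    by (simp add: complex_eq_iff)
  then show ?thesis
    using assms xi_integral_eq[of "Im z" c z] by (simp add: xi_c_def P_def)
qed

text \<open>\<open>P\<close> contributes \<open>A \<i> = 0\<close>, and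
  \<open>B \<i> * cnj v\<close> has no z-derivative. The tail is the conjugate of a holomorphic
  function of \<open>cnj z\<close>, so its derivative enters in full. The bound on \<open>c\<close>
  puts \<open>\<i>\<close> inside the strip where \<open>xi_c_eq\<close> holds.\<close>

lemma wirtinger_xi_c:
  assumes "1 < c"
  shows "wirtinger (xi_c f c) \<i> = - cnj (S1 c (- \<i> + 2 * \<i> * of_real c))"
proof -
  define s where "s = S1 c (- \<i> + 2 * \<i> * of_real c)"
  have "((\<lambda>z. S c (cnj z + 2 * \<i> * of_real c)) has_derivative (\<lambda>v. s * cnj v)) (at \<i>)"
  proof -
    have "((\<lambda>z. cnj z + 2 * \<i> * of_real c) has_derivative cnj) (at \<i>)"
      by (auto intro!: derivative_eq_intros)
    moreover have "(S c has_derivative (\<lambda>v. s * v)) (at (cnj \<i> + 2 * \<i> * of_real c))"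
      using S_deriv[of "- \<i> + 2 * \<i> * of_real c" c] assms
      by (simp add: has_field_derivative_def s_def)
    ultimately show ?thesis
      by (rule has_derivative_compose)
  qed
  from has_derivative_diff[OF P_deriv has_derivative_cnj[OF this]]
  have "((\<lambda>z. P z - cnj (S c (cnj z + 2 * \<i> * of_real c))) has_derivative
      (\<lambda>v. A \<i> * v + B \<i> * cnj v - cnj (s * cnj v))) (at \<i>)"
    by simp
  then have "(xi_c f c has_derivative (\<lambda>v. A \<i> * v + B \<i> * cnj v - cnj (s * cnj v))) (at \<i>)"
  proof (rule has_derivative_transform_within_open)
    show "open {z. 0 < Im z \<and> Im z < c}"
      by (intro open_Collect_conj open_halfspace_Im_gt open_halfspace_Im_lt)
  qed (use assms xi_c_eq in auto)
  from frechet_derivative_at[OF this, symmetric]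
  show ?thesis
    unfolding wirtinger_def s_def[symmetric] by (simp add: A_i algebra_simps)
qed

text \<open>The displacement \<open>cnj z + \<i>\<close> does not depend on \<open>c\<close>, so a
  bound of order \<open>1 / c\<close> on \<open>S2 c\<close> suffices. At heights at least
  \<open>c\<close> its weights of order \<open>c\<^sup>2\<close>, \<open>c\<close> and 1 meet decay
  of order 3, 2 and 1, giving \<open>4 * D / c\<close>, \<open>D / (2 * c)\<close> and
  \<open>D / (4 * c)\<close>.\<close>

lemma Taylor_remainder_tendsto_0:
  assumes z: "0 \<le> Im z"
  shows "((\<lambda>c. S c (cnj z + 2 * \<i> * of_real c) - S c (- \<i> + 2 * \<i> * of_real c)
    - S1 c (- \<i> + 2 * \<i> * of_real c) * (cnj z + \<i>)) \<longlongrightarrow> 0) at_top"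
proof (rule Lim_null_comparison)
  show "\<forall>\<^sub>F c in at_top. norm (S c (cnj z + 2 * \<i> * of_real c) - S c (- \<i> + 2 * \<i> * of_real c)
    - S1 c (- \<i> + 2 * \<i> * of_real c) * (cnj z + \<i>)) \<le> 5 * D * (norm (cnj z + \<i>))\<^sup>2 * inverse c"
    using eventually_ge_at_top[of "max 1 (Im z)"]
  proof eventually_elim
    case (elim c)
    then have c: "1 \<le> c" "Im z \<le> c" by auto
    \<comment> \<open>Both points have height at least \<open>c\<close>: the heights are
      \<open>2 * c - Im z\<close> and \<open>2 * c - 1\<close>.\<close>
    define X where "X = {u. c \<le> Im u}"
    define g where "g n = (if n = 0 then S c else if n = 1 then S1 c else S2 c)" for n :: nat
    have "norm (g 0 (cnj z + 2 * \<i> * of_real c) - (\<Sum>i\<le>1. g i (- \<i> + 2 * \<i> * of_real c) *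
        ((cnj z + 2 * \<i> * of_real c) - (- \<i> + 2 * \<i> * of_real c)) ^ i / fact i))
      \<le> (5 * D / c) * norm ((cnj z + 2 * \<i> * of_real c) - (- \<i> + 2 * \<i> * of_real c)) ^ Suc 1 / fact 1"
    proof (rule complex_Taylor[of X])
      show "convex X" unfolding X_def by (rule convex_halfspace_Im_ge)
      show "(g i has_field_derivative g (Suc i) x) (at x within X)" if "x \<in> X" "i \<le> 1" for i x
      proof -
        have "0 < Im x" using that c by (auto simp: X_def)
        moreover have "i = 0 \<or> i = 1" using that by auto
        ultimately show ?thesis
          by (auto simp: g_def intro!: has_field_derivative_at_within S_deriv S1_deriv)
      qed
      show "norm (g (Suc 1) w) \<le> 5 * D / c" if "w \<in> X" for w
      proof -
        have w: "c \<le> Im w" "0 < Im w" using that c by (auto simp: X_def)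
        have "norm (deriv f w) \<le> 8 * D / Im w ^ 3"
          using norm_deriv_upper_half_plane_le[OF holo w(2) f_bound D_pos] .
        also have "\<dots> \<le> 8 * D / c ^ 3"
          using w c D_pos by (intro divide_left_mono power_mono mult_pos_pos) auto
        finally have "c\<^sup>2 / 2 * norm (deriv f w) \<le> c\<^sup>2 / 2 * (8 * D / c ^ 3)"
          by (intro mult_left_mono) auto
        also have "\<dots> = 4 * D / c"
          using c by (simp add: field_simps power2_eq_square power3_eq_cube)
        finally have 1: "c\<^sup>2 / 2 * norm (deriv f w) \<le> 4 * D / c" .
        have "norm (f w) \<le> D / c\<^sup>2"
        proof -
          have "D / (Im w)\<^sup>2 \<le> D / c\<^sup>2"
            using w c D_pos by (intro divide_left_mono power_mono mult_pos_pos) auto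
          with f_bound[OF w(2)] show ?thesis by linarith
        qed
        then have "c / 2 * norm (f w) \<le> c / 2 * (D / c\<^sup>2)"
          using c by (intro mult_left_mono) auto
        also have "\<dots> = D / (2 * c)"
          using c by (simp add: field_simps power2_eq_square)
        finally have 2: "c / 2 * norm (f w) \<le> D / (2 * c)" .
        have "norm (F1 w) \<le> D / c"
        proof -
          have "D / Im w \<le> D / c"
            using w c D_pos by (intro divide_left_mono mult_pos_pos) auto
          with F1_bound[OF w(2)] show ?thesis by linarith
        qed
        then have 3: "norm (F1 w) / 4 \<le> D / (4 * c)"
          by simp
        have "norm (S2 c w) \<le> norm ((of_real c)\<^sup>2 / 2 * deriv f w) + norm (\<i> * of_real c / 2 * f w) + norm (F1 w / 4)"
          unfolding S2_def by (rule order_trans[OF norm_triangle_ineq4 add_right_mono[OF norm_triangle_ineq]])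
        also have "\<dots> = c\<^sup>2 / 2 * norm (deriv f w) + c / 2 * norm (f w) + norm (F1 w) / 4"
          using c by (simp add: norm_mult norm_divide norm_power)
        also have "\<dots> \<le> 4 * D / c + D / (2 * c) + D / (4 * c)"
          by (intro add_mono 1 2 3)
        also have "\<dots> \<le> 5 * D / c"
          using c D_pos by (simp add: field_simps)
        finally show ?thesis by (simp add: g_def)
      qed
    qed (use c in \<open>auto simp: X_def\<close>)
    then show ?case
      by (simp add: g_def power2_eq_square field_simps)
  qed
  show "((\<lambda>c. 5 * D * (norm (cnj z + \<i>))\<^sup>2 * inverse c) \<longlongrightarrow> 0) at_top"
    by (intro tendsto_mult_right_zero tendsto_inverse_0_at_top filterlim_ident)
qed

text \<open>The free \<open>l\<close> covers two cases: it is \<open>P z\<close> at interior points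
  and the vertical limit of \<open>P\<close> at real points.\<close>

lemma xi_c_normalized_tendsto:
  assumes z: "0 \<le> Im z"
    and eq: "\<forall>\<^sub>F c in at_top. xi_c f c z = l - cnj (S c (cnj z + 2 * \<i> * of_real c))"
  shows "((\<lambda>c. xi_c_normalized f c z) \<longlongrightarrow> l) at_top"
proof -
  have "\<forall>\<^sub>F c in at_top. l - cnj (S c (cnj z + 2 * \<i> * of_real c) - S c (- \<i> + 2 * \<i> * of_real c)
    - S1 c (- \<i> + 2 * \<i> * of_real c) * (cnj z + \<i>)) = xi_c_normalized f c z"
    using eq eventually_gt_at_top[of 1]
  proof eventually_elim
    case (elim c)
    have "xi_c f c \<i> = - cnj (S c (- \<i> + 2 * \<i> * of_real c))"
      using xi_c_eq[of \<i> c] elim(2) by (simp add: P_i)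
    then show ?case
      by (simp add: xi_c_normalized_def elim(1) wirtinger_xi_c[OF elim(2)] algebra_simps)
  qed
  moreover have "((\<lambda>c. l - cnj (S c (cnj z + 2 * \<i> * of_real c) - S c (- \<i> + 2 * \<i> * of_real c)
    - S1 c (- \<i> + 2 * \<i> * of_real c) * (cnj z + \<i>))) \<longlongrightarrow> l - cnj 0) at_top"
    by (intro tendsto_intros Taylor_remainder_tendsto_0 z)
  ultimately have "((\<lambda>c. xi_c_normalized f c z) \<longlongrightarrow> l - cnj 0) at_top"
    by (rule Lim_transform_eventually[rotated])
  then show ?thesis by simp
qed

text \<open>For real \<open>z\<close> the lower limit \<open>\<epsilon>\<close> corresponds to a
  point \<open>w \<epsilon>\<close> of height \<open>2 * \<epsilon>\<close>. The boundary term is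
  therefore \<open>S \<epsilon>\<close> there, whereas \<open>P\<close> uses
  \<open>S (2 * \<epsilon>)\<close>; the mismatch consists of
  \<open>\<epsilon>\<^sup>2 * F1\<close>, of order \<open>\<epsilon>\<close>, and
  \<open>\<epsilon> * F2\<close>, of order \<open>sqrt \<epsilon>\<close>.\<close>

lemma xi_integral_tendsto:
  assumes z: "Im z = 0" and c: "0 < c"
    and l: "((\<lambda>s. P (z + \<i> * of_real s)) \<longlongrightarrow> l) (at_right 0)"
  shows "((\<lambda>\<epsilon>. xi_integral f z \<epsilon> c) \<longlongrightarrow> l - cnj (S c (cnj z + 2 * \<i> * of_real c))) (at_right 0)"
proof -
  define w where "w \<epsilon> = z + \<i> * of_real (2 * \<epsilon>)" for \<epsilon> :: real
  \<comment> \<open>The coefficient from \<open>F2_bound\<close>, with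
    \<open>norm (w \<epsilon>) \<le> norm z + 1\<close> for
    \<open>\<epsilon> < 1 / 2\<close>.\<close>
  define M where "M = (norm (F2 \<i>) + 5 * D) * sqrt (2 + norm z)"
  have M: "0 \<le> M" using D_pos by (simp add: M_def)
  have Im_w: "Im (w \<epsilon>) = 2 * \<epsilon>" for \<epsilon> using z by (simp add: w_def)
  have cz: "cnj z = z" using z by (simp add: complex_eq_iff)
  have lim_w: "((\<lambda>\<epsilon>. P (w \<epsilon>)) \<longlongrightarrow> l) (at_right 0)"
    unfolding w_def
  proof (rule filterlim_compose[OF l])
    show "filterlim (\<lambda>\<epsilon>::real. 2 * \<epsilon>) (at_right 0) (at_right 0)"
      unfolding filterlim_at by (auto intro!: tendsto_eq_intros simp: eventually_at_right_less eventually_at_filter)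
  qed
  have diff: "((\<lambda>\<epsilon>. S \<epsilon> (w \<epsilon>) - S (2 * \<epsilon>) (w \<epsilon>)) \<longlongrightarrow> 0) (at_right 0)"
  proof (rule Lim_null_comparison)
    have "\<forall>\<^sub>F \<epsilon> in at_right 0. 0 < \<epsilon> \<and> \<epsilon> < (1 / 2 :: real)"
      by (auto simp: eventually_at_right[of 0 1] intro!: exI[of _ "1 / 2"])
    then show "\<forall>\<^sub>F \<epsilon> in at_right 0. norm (S \<epsilon> (w \<epsilon>) - S (2 * \<epsilon>) (w \<epsilon>)) \<le> D * \<epsilon> + M * (\<epsilon> + sqrt \<epsilon>)"
    proof eventually_elim
      case (elim \<epsilon>)
      then have \<epsilon>: "0 < \<epsilon>" "\<epsilon> < 1 / 2" by auto
      have "S \<epsilon> (w \<epsilon>) - S (2 * \<epsilon>) (w \<epsilon>) = - (of_real (3 / 2 * \<epsilon>\<^sup>2) * F1 (w \<epsilon>)) - \<i> * of_real (\<epsilon> / 2) * F2 (w \<epsilon>)"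
        by (simp add: S_def field_simps power2_eq_square)
      then have "norm (S \<epsilon> (w \<epsilon>) - S (2 * \<epsilon>) (w \<epsilon>)) \<le>
          norm (of_real (3 / 2 * \<epsilon>\<^sup>2) * F1 (w \<epsilon>)) + norm (\<i> * of_real (\<epsilon> / 2) * F2 (w \<epsilon>))"
        using norm_triangle_ineq4[of "- (of_real (3 / 2 * \<epsilon>\<^sup>2) * F1 (w \<epsilon>))" "\<i> * of_real (\<epsilon> / 2) * F2 (w \<epsilon>)"]
        by (simp only: norm_minus_cancel)
      also have "norm (of_real (3 / 2 * \<epsilon>\<^sup>2) * F1 (w \<epsilon>)) = 3 / 2 * \<epsilon>\<^sup>2 * norm (F1 (w \<epsilon>))"
        by (simp only: norm_mult norm_of_real) simp
      also have "\<dots> \<le> 3 / 2 * \<epsilon>\<^sup>2 * (D / (2 * \<epsilon>))"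
        using F1_bound[of "w \<epsilon>"] \<epsilon> by (intro mult_left_mono) (auto simp: Im_w)
      also have "\<dots> \<le> D * \<epsilon>"
        using \<epsilon> D_pos by (simp add: field_simps power2_eq_square)
      also have "norm (\<i> * of_real (\<epsilon> / 2) * F2 (w \<epsilon>)) \<le> \<epsilon> * norm (F2 (w \<epsilon>))"
        using \<epsilon> by (simp add: norm_mult norm_divide)
      also have "\<dots> \<le> \<epsilon> * (M * (1 + 1 / sqrt \<epsilon>))"
      proof (rule mult_left_mono)
        have "norm (w \<epsilon>) \<le> norm z + 2 * \<epsilon>"
          unfolding w_def by (rule order_trans[OF norm_triangle_ineq]) (use \<epsilon> in \<open>simp add: norm_mult\<close>)
        then have "sqrt (1 + norm (w \<epsilon>)) \<le> sqrt (2 + norm z)"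
          using \<epsilon> by simp
        moreover have "1 / sqrt (Im (w \<epsilon>)) \<le> 1 / sqrt \<epsilon>"
          using \<epsilon> unfolding Im_w by (intro divide_left_mono mult_pos_pos) auto
        ultimately have "(norm (F2 \<i>) + 5 * D) * sqrt (1 + norm (w \<epsilon>)) * (1 + 1 / sqrt (Im (w \<epsilon>)))
            \<le> M * (1 + 1 / sqrt \<epsilon>)"
          unfolding M_def using D_pos \<epsilon> by (intro mult_mono) (auto simp: Im_w)
        then show "norm (F2 (w \<epsilon>)) \<le> M * (1 + 1 / sqrt \<epsilon>)"
          using F2_bound[of "w \<epsilon>"] \<epsilon> by (simp add: Im_w)
      qed (use \<epsilon> in simp)
      also have "\<epsilon> * (M * (1 + 1 / sqrt \<epsilon>)) = M * (\<epsilon> + \<epsilon> / sqrt \<epsilon>)"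
        by (simp add: algebra_simps)
      also have "\<epsilon> / sqrt \<epsilon> = sqrt \<epsilon>"
        using \<epsilon> by (simp add: real_div_sqrt)
      finally show ?case by simp
    qed
    show "((\<lambda>\<epsilon>. D * \<epsilon> + M * (\<epsilon> + sqrt \<epsilon>)) \<longlongrightarrow> 0) (at_right 0)"
      by (auto intro!: tendsto_eq_intros)
  qed
  have "((\<lambda>\<epsilon>. P (w \<epsilon>) + cnj (S \<epsilon> (w \<epsilon>) - S (2 * \<epsilon>) (w \<epsilon>)) - cnj (S c (cnj z + 2 * \<i> * of_real c)))
      \<longlongrightarrow> l + cnj 0 - cnj (S c (cnj z + 2 * \<i> * of_real c))) (at_right 0)"
    by (intro tendsto_intros lim_w diff)
  moreover have "\<forall>\<^sub>F \<epsilon> in at_right 0. P (w \<epsilon>) + cnj (S \<epsilon> (w \<epsilon>) - S (2 * \<epsilon>) (w \<epsilon>))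
      - cnj (S c (cnj z + 2 * \<i> * of_real c)) = xi_integral f z \<epsilon> c"
    using eventually_at_right_less[of 0]
  proof eventually_elim
    case (elim \<epsilon>)
    have "w \<epsilon> = cnj z + 2 * \<i> * of_real \<epsilon>" by (simp add: w_def cz)
    then show ?case
      using xi_integral_eq[of \<epsilon> c z] elim c z by (simp add: P_def Im_w)
  qed
  ultimately have "((\<lambda>\<epsilon>. xi_integral f z \<epsilon> c)
      \<longlongrightarrow> l + cnj 0 - cnj (S c (cnj z + 2 * \<i> * of_real c))) (at_right 0)"
    by (rule Lim_transform_eventually)
  then show ?thesis by simp
qed

end


subsection \<open>The Cayley transform\<close>

lemma cayley_push_eq:
  assumes "0 \<le> Im z"
  shows "cayley_push z v = 2 * \<i> / (z + \<i>)\<^sup>2 * v"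
proof -
  have "z + \<i> \<noteq> 0"
    using assms by (auto simp: complex_eq_iff)
  then have "(cayley has_field_derivative 2 * \<i> / (z + \<i>)\<^sup>2) (at z)"
    unfolding cayley_def[abs_def]
    by (auto intro!: derivative_eq_intros simp: field_simps power2_eq_square)
  then have "(cayley has_derivative (\<lambda>v. 2 * \<i> / (z + \<i>)\<^sup>2 * v)) (at z)"
    by (simp only: has_field_derivative_def)
  from frechet_derivative_at[OF this] show ?thesis
    unfolding cayley_push_def by metis
qed

text \<open>The differential of the Cayley transform decays like \<open>|z|\<^bsup>-2\<^esup>\<close>, which beats the growth
  \<open>|z|\<^bsup>3/2\<^esup>\<close> of the field.\<close>

lemma cayley_extension:
  assumes cont: "continuous_on {z. 0 \<le> Im z} \<xi>"
    and growth: "\<And>z. 0 \<le> Im z \<Longrightarrow> norm (\<xi> z) \<le> C * ((1 + norm z) * sqrt (1 + norm z))"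
  obtains V where "continuous_on (cball 0 1) V"
    and "\<And>z. 0 \<le> Im z \<Longrightarrow> V (cayley z) = cayley_push z (\<xi> z)"
    and "V 1 = 0"
proof -
  \<comment> \<open>\<open>c\<close> inverts the Cayley transform. As
    \<open>1 - w = 2 * \<i> / (z + \<i>)\<close>, the factor in \<open>V\<close> is the differential
    \<open>2 * \<i> / (z + \<i>)\<^sup>2\<close>; it vanishes at \<open>w = 1\<close>, so the
    default value of the division in \<open>c 1\<close> does no harm.\<close>
  define c where "c w = \<i> * (1 + w) / (1 - w)" for w :: complex
  define V where "V w = - \<i> / 2 * (1 - w)\<^sup>2 * \<xi> (c w)" for w
  have C: "0 \<le> C"
    using growth[of 0] norm_ge_zero[of "\<xi> 0"] by (simp del: norm_ge_zero)
  have Im_c: "0 \<le> Im (c w)" if w: "norm w \<le> 1" for w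
  proof -
    have "Im (c w) = (1 - (norm w)\<^sup>2) / (norm (1 - w))\<^sup>2"
      unfolding c_def Im_divide cmod_power2 by (simp add: algebra_simps power2_eq_square)
    moreover have "(norm w)\<^sup>2 \<le> 1"
      using w by (simp add: power_le_one)
    ultimately show ?thesis by simp
  qed
  have c_cayley: "c (cayley z) = z" "1 - cayley z = 2 * \<i> / (z + \<i>)" if "0 \<le> Im z" for z
  proof -
    have nz: "z + \<i> \<noteq> 0"
      using that by (auto simp: complex_eq_iff)
    show 1: "1 - cayley z = 2 * \<i> / (z + \<i>)"
      using nz by (simp add: cayley_def field_simps)
    have 2: "1 + cayley z = 2 * z / (z + \<i>)"
      using nz by (simp add: cayley_def field_simps)
    have "\<i> * (2 * z / a) / (2 * \<i> / a) = z" if "a \<noteq> 0" for a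
      using that by (simp add: field_simps)
    from this[OF nz] show "c (cayley z) = z"
      unfolding c_def 1 2 .
  qed
  have cont_V: "continuous_on (cball 0 1 - {1}) V"
    unfolding V_def c_def
    by (intro continuous_intros continuous_on_compose2[OF cont])
       (use Im_c in \<open>auto simp: c_def\<close>)
  \<comment> \<open>With \<open>r = norm (1 - w)\<close>, the point \<open>c w\<close> has norm at
    most \<open>2 / r\<close>: growth of order \<open>r\<close> to the power -3/2 against the factor
    \<open>r\<^sup>2\<close> leaves \<open>sqrt r\<close>.\<close>
  have V_bound: "norm (V w) \<le> 3 * C * sqrt (6 * norm (1 - w))" if w: "norm w \<le> 1" for w
  proof (cases "w = 1")
    case False
    define r where "r = norm (1 - w)"
    have r: "0 < r" "r \<le> 2"
      using False w norm_triangle_ineq4[of 1 w] by (auto simp: r_def)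
    have "norm (c w) \<le> 2 / r"
      unfolding c_def norm_divide norm_mult r_def[symmetric]
      using norm_triangle_ineq[of 1 w] w r by (intro divide_right_mono) auto
    moreover have "1 \<le> 2 / r"
      using r by simp
    ultimately have c: "1 + norm (c w) \<le> 6 / r"
      using r by (simp add: field_simps)
    have "norm (V w) = r\<^sup>2 / 2 * norm (\<xi> (c w))"
      by (simp add: V_def norm_mult norm_power norm_divide r_def)
    also have "\<dots> \<le> r\<^sup>2 / 2 * (C * ((6 / r) * sqrt (6 / r)))"
    proof (rule mult_left_mono)
      have "(1 + norm (c w)) * sqrt (1 + norm (c w)) \<le> (6 / r) * sqrt (6 / r)"
        using c r by (intro mult_mono) auto
      from mult_left_mono[OF this C] growth[OF Im_c[OF w]]
      show "norm (\<xi> (c w)) \<le> C * ((6 / r) * sqrt (6 / r))" by linarith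
    qed simp
    also have "\<dots> = 3 * C * (r * sqrt (6 / r))"
      using r by (simp add: power2_eq_square)
    also have "r * sqrt (6 / r) = sqrt (r\<^sup>2 * (6 / r))"
      using r by (simp only: real_sqrt_mult real_sqrt_abs abs_of_pos)
    also have "r\<^sup>2 * (6 / r) = 6 * r"
      using r by (simp add: power2_eq_square)
    finally show ?thesis by (simp add: r_def)
  qed (simp add: V_def)
  have V1: "V 1 = 0" by (simp add: V_def)
  have "continuous_on (cball 0 1) V"
    unfolding continuous_on_eq_continuous_within
  proof
    fix w :: complex assume w: "w \<in> cball 0 1"
    show "continuous (at w within cball 0 1) V"
    proof (cases "w = 1")
      case True
      have "(V \<longlongrightarrow> 0) (at 1 within cball 0 1)"
      proof (rule Lim_null_comparison)
        show "\<forall>\<^sub>F u in at 1 within cball 0 1. norm (V u) \<le> 3 * C * sqrt (6 * norm (1 - u))"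
          using V_bound by (auto simp: eventually_at_filter)
        have "((\<lambda>u::complex. 3 * C * sqrt (6 * norm (1 - u))) \<longlongrightarrow> 3 * C * sqrt (6 * norm (1 - 1 :: complex)))
            (at 1 within cball 0 1)"
          by (intro tendsto_intros)
        then show "((\<lambda>u::complex. 3 * C * sqrt (6 * norm (1 - u))) \<longlongrightarrow> 0) (at 1 within cball 0 1)"
          by simp
      qed
      then show ?thesis
        by (simp add: True continuous_within V1)
    next
      case False
      then have "continuous (at w within cball 0 1 - {1}) V"
        using cont_V w by (auto simp: continuous_on_eq_continuous_within)
      moreover have "at w within cball 0 1 - {1} = at w within cball 0 1"
        by (rule at_within_nhd[of _ "- {1}"]) (use False in auto)
      ultimately show ?thesis by simp
    qed
  qed
  moreover have "V (cayley z) = cayley_push z (\<xi> z)" if z: "0 \<le> Im z" for z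
    using z by (simp add: V_def c_cayley cayley_push_eq power_divide power_mult_distrib)
  ultimately show ?thesis
    using V1 by (rule that)
qed

section \<open>Assembly of the harmonic field and its extension\<close>

lemma harmonic_vector_field_cong:
  assumes "harmonic_vector_field U \<xi>" and eq: "\<And>z. z \<in> U \<Longrightarrow> \<xi> z = \<xi>' z"
  shows "harmonic_vector_field U \<xi>'"
proof -
  have "smooth_on U \<xi>'"
    using assms(1) eq by (auto simp: harmonic_vector_field_def intro: smooth_on_cong)
  then show ?thesis
    using assms(1) eq unfolding harmonic_vector_field_def by simp
qed

theorem theorem2:
  fixes f :: "complex \<Rightarrow> complex" and D :: real
  assumes "f holomorphic_on upper_half_plane"
    and "D > 0"
    and "\<And>z. z \<in> upper_half_plane \<Longrightarrow> cmod (f z) * (Im z)\<^sup>2 \<le> D"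
    and "hyp_bounded_tensor 3 (cov_deriv (quad_diff f))"
    and "hyp_bounded_tensor 4 (cov_deriv (cov_deriv (quad_diff f)))"
  shows "\<exists>\<xi> :: complex \<Rightarrow> complex.
      harmonic_vector_field upper_half_plane \<xi> \<and>
      (\<forall>z\<in>upper_half_plane. lie_metric_20 \<xi> z = f z) \<and>
      (\<forall>z\<in>upper_half_plane. ((\<lambda>c. xi_c_normalized f c z) \<longlongrightarrow> \<xi> z) at_top) \<and>
      (\<forall>z\<in>\<real>. (\<forall>c>0. ((\<lambda>\<epsilon>. xi_integral f z \<epsilon> c) \<longlongrightarrow> xi_c f c z) (at_right 0)) \<and>
               ((\<lambda>c. xi_c_normalized f c z) \<longlongrightarrow> \<xi> z) at_top) \<and>
      (\<exists>V :: complex \<Rightarrow> complex.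
         continuous_on (cball 0 1) V \<and>
         (\<forall>z\<in>upper_half_plane. V (cayley z) = cayley_push z (\<xi> z)) \<and>
         (\<forall>z\<in>\<real>. V (cayley z) = cayley_push z (\<xi> z)) \<and>
         V 1 = 0)"
proof -
  have "cmod (f z) \<le> D / (Im z)\<^sup>2" if "0 < Im z" for z
    using assms(3)[of z] that by (simp add: field_simps)
  then obtain F1 F2 F3 where "bounded_differential f F1 F2 F3 D"
    using bounded_differential_exists[OF assms(1,2)] by blast
  then interpret bounded_differential f F1 F2 F3 D .
  have "0 \<le> K"
    using D_pos by (simp add: K_def)
  then obtain \<xi> C where cont: "continuous_on {z. 0 \<le> Im z} \<xi>"
    and \<xi>_P: "\<And>z. 0 < Im z \<Longrightarrow> \<xi> z = P z"
    and growth: "\<And>z. 0 \<le> Im z \<Longrightarrow> norm (\<xi> z) \<le> C * ((1 + norm z) * sqrt (1 + norm z))"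
    and lim: "\<And>z. 0 \<le> Im z \<Longrightarrow> ((\<lambda>s. P (z + \<i> * of_real s)) \<longlongrightarrow> \<xi> z) (at_right 0)"
    using half_plane_extension[OF P_deriv P_gradient_bound] by blast
  obtain V where V: "continuous_on (cball 0 1) V" "V 1 = 0"
    "\<And>z. 0 \<le> Im z \<Longrightarrow> V (cayley z) = cayley_push z (\<xi> z)"
    using cayley_extension[OF cont growth] by blast
  have harmonic: "harmonic_vector_field upper_half_plane \<xi>"
    by (rule harmonic_vector_field_cong[OF harmonic_P]) (simp add: \<xi>_P)
  have lie: "lie_metric_20 \<xi> z = f z" if z: "0 < Im z" for z
  proof -
    have "(\<xi> has_derivative (\<lambda>v. A z * v + B z * cnj v)) (at z)"
      by (rule has_derivative_transform_within_open[OF P_deriv[OF z] open_upper_half_plane])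
         (use z \<xi>_P in auto)
    from lie_metric_20_eq[OF z this] show ?thesis
      using z by (simp add: B_def)
  qed
  have upper: "((\<lambda>c. xi_c_normalized f c z) \<longlongrightarrow> \<xi> z) at_top" if z: "0 < Im z" for z
  proof (rule xi_c_normalized_tendsto)
    show "\<forall>\<^sub>F c in at_top. xi_c f c z = \<xi> z - cnj (S c (cnj z + 2 * \<i> * of_real c))"
      using eventually_gt_at_top[of "Im z"]
      by eventually_elim (simp add: xi_c_eq z \<xi>_P)
  qed (use z in simp)
  have real_c: "((\<lambda>\<epsilon>. xi_integral f z \<epsilon> c) \<longlongrightarrow> xi_c f c z) (at_right 0)"
    "xi_c f c z = \<xi> z - cnj (S c (cnj z + 2 * \<i> * of_real c))" if z: "Im z = 0" and c: "0 < c" for z c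
  proof -
    \<comment> \<open>Existence of the limit comes first; only then is the \<open>Lim\<close> in
      \<open>xi_c\<close> known to be its value.\<close>
    have t: "((\<lambda>\<epsilon>. xi_integral f z \<epsilon> c) \<longlongrightarrow> \<xi> z - cnj (S c (cnj z + 2 * \<i> * of_real c))) (at_right 0)"
      by (rule xi_integral_tendsto[OF z c lim]) (simp add: z)
    show 1: "xi_c f c z = \<xi> z - cnj (S c (cnj z + 2 * \<i> * of_real c))"
      using tendsto_Lim[OF _ t] by (simp add: xi_c_def z)
    show "((\<lambda>\<epsilon>. xi_integral f z \<epsilon> c) \<longlongrightarrow> xi_c f c z) (at_right 0)"
      unfolding 1 by (rule t)
  qed
  have real: "((\<lambda>c. xi_c_normalized f c z) \<longlongrightarrow> \<xi> z) at_top" if z: "Im z = 0" for z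
  proof (rule xi_c_normalized_tendsto)
    show "\<forall>\<^sub>F c in at_top. xi_c f c z = \<xi> z - cnj (S c (cnj z + 2 * \<i> * of_real c))"
      using eventually_gt_at_top[of 0] by eventually_elim (rule real_c(2)[OF z])
  qed (use z in simp)
  show ?thesis
    by (intro exI[of _ \<xi>] exI[of _ V] conjI ballI allI impI)
       (use harmonic lie upper real_c(1) real V in \<open>auto simp: complex_is_Real_iff\<close>)
qed

end
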